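(* Let $p,q$ be positive integers. Let $\alpha(\lambda)=\sum_{j=0}^m\lambda^ja_j$ and $\beta(\lambda)=\sum_{j=0}^m\lambda^jb_j$ be matrix polynomials in $\lambda$ of sizes $p\times p$ and $p\times q$, and let $\gamma(\lambda)=\sum_{j=0}^m\lambda^{-j}c_{-j}$ and $\delta(\lambda)=\sum_{j=0}^m\lambda^{-j}d_{-j}$ be matrix polynomials in $\lambda^{-1}$ of sizes $q\times p$ and $q\times q$; thus $m$ is an upper bound of the degrees of $\alpha,\beta,\gamma,\delta$. Assume that $a_0$ and $d_0$ are invertible. Then there exists a solution $g$ to the twofold EG inverse problem associated with $\{\alpha,\beta,\gamma,\delta\}$ if and only if on $\mathbb T$ $$\alpha^*\alpha-\gamma^*\gamma=a_0,\qquad \delta^*\delta-\beta^*\beta=d_0,\qquad \alpha^*\beta=\gamma^*\delta.$$ Moreover, this solution $g$ is unique, it is a matrix polynomial in $\lambda$ with $\deg g\le m$, and its coefficients $g_0,\dots,g_m$ are given by $$-\begin{bmatrix} b_m&\cdots&b_0\\ &\ddots&\vdots\\ &&b_m\end{bmatrix}\begin{bmatrix}e_m\\ \vdots\\ e_0\end{bmatrix}=\begin{bmatrix}g_0\\ \vdots\\ g_m\end{bmatrix}=-\begin{bmatrix}a_0^*&\cdots&a_m^*\\ &\ddots&\vdots\\ &&a_0^*\end{bmatrix}^{-1}\begin{bmatrix}c_0^*\\ \vdots\\ c_{-m}^*\end{bmatrix},$$ where the $q\times q$ matrices $e_0,\dots,e_m$ are defined by $$\begin{bmatrix}e_m\\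 \vdots\\ e_0\end{bmatrix}=\begin{bmatrix}d_0&\cdots&d_{-m}\\ &\ddots&\vdots\\ &&d_0\end{bmatrix}^{-1}\begin{bmatrix}0\\ \vdots\\ 0\\ I_q\end{bmatrix}.$$
   Context: The displayed $(m+1)\times(m+1)$ block matrices are upper triangular block Toeplitz: for $0\le i\le j\le m$ their $(i,j)$ block entries are $b_{m+i-j}$, $a_{j-i}^*$ and $d_{i-j}$, respectively, and the blocks below the diagonal are zero. Wiener spaces. $\mathcal W^{n\times m}$ is the set of $n\times m$ matrix functions on the unit circle $\mathbb T$ whose entries lie in the Wiener algebra, i.e. $\rho(\zeta)=\sum_{\nu\in\mathbb Z}\zeta^\nu r_\nu$ with $\sum_\nu\|r_\nu\|<\infty$. $\mathcal W_+^{n\times m}$ consists of those with $r_\nu=0$ for $\nu<0$; $\mathcal W_{+,0}^{n\times m}$ (resp. $\mathcal W_{-,0}^{n\times m}$) of those with $r_\nu=0$ for $\nu\le0$ (resp. $\nu\ge0$). Put $\rho^*(\zeta)=\rho(\zeta)^*$ for $\zeta\in\mathbb T$. Constant matrices are identified with constant functions. Twofold EG inverse problem. A solution associated with $\{\alpha,\beta,\gamma,\delta\}$ is a function $g\in\mathcal W_+^{p\times q}$ such that $\alpha+g\gamma-I_p\in\mathcal W_{-,0}^{p\times p}$, $\ g^*\alpha+\gamma\in\mathcal W_{+,0}^{q\times p}$, $\ \delta+g^*\beta-I_q\in\mathcal W_{+,0}^{q\times q}$, $\ g\delta+\beta\in\mathcal W_{-,0}^{p\times q}$. *)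

theory Defs
  imports "HOL-Analysis.Analysis"
begin

text \<open>
  A \<open>k\<close> by \<open>n\<close> complex matrix has type \<^typ>\<open>complex^'n^'k\<close> (the outer index is the row index).
\<close>

definition conj_transpose :: "complex^'n^'k \<Rightarrow> complex^'k^'n"  (\<open>(_\<^sup>H)\<close> [1000] 999)
  where "A\<^sup>H = (\<chi> i j. cnj (A $ j $ i))"

text \<open>The library's \<^const>\<open>vector_scalar_mult\<close> acts on one index level only.\<close>

definition mscale :: "complex \<Rightarrow> complex^'n^'k \<Rightarrow> complex^'n^'k"  (infixr \<open>*\<^sub>m\<close> 75)
  where "c *\<^sub>m A = (\<chi> i j. c * A $ i $ j)"

text \<open>
  Functions on the unit circle are total functions on \<^typ>\<open>complex\<close> whose values off the circle
  play no role; they are equal as functions on the circle if they agree on \<^term>\<open>sphere (0::complex) 1\<close>.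
  The norm below is the Frobenius norm; in finite dimension the choice is irrelevant for summability.
\<close>

definition wiener_series :: "(int \<Rightarrow> complex^'n^'k) \<Rightarrow> (complex \<Rightarrow> complex^'n^'k) \<Rightarrow> bool"
  where "wiener_series r \<rho> \<longleftrightarrow>
    (\<lambda>\<nu>. norm (r \<nu>)) summable_on UNIV \<and>
    (\<forall>\<zeta>\<in>sphere 0 1. ((\<lambda>\<nu>. (\<zeta> powi \<nu>) *\<^sub>m r \<nu>) has_sum \<rho> \<zeta>) UNIV)"

definition wiener_plus :: "(complex \<Rightarrow> complex^'n^'k) set"
  where "wiener_plus = {\<rho>. \<exists>r. wiener_series r \<rho> \<and> (\<forall>\<nu><0. r \<nu> = 0)}"

definition wiener_plus_0 :: "(complex \<Rightarrow> complex^'n^'k) set"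
  where "wiener_plus_0 = {\<rho>. \<exists>r. wiener_series r \<rho> \<and> (\<forall>\<nu>\<le>0. r \<nu> = 0)}"

definition wiener_minus_0 :: "(complex \<Rightarrow> complex^'n^'k) set"
  where "wiener_minus_0 = {\<rho>. \<exists>r. wiener_series r \<rho> \<and> (\<forall>\<nu>\<ge>0. r \<nu> = 0)}"

definition twofold_EG_solution ::
  "(complex \<Rightarrow> complex^'p^'p) \<Rightarrow> (complex \<Rightarrow> complex^'q^'p) \<Rightarrow>
   (complex \<Rightarrow> complex^'p^'q) \<Rightarrow> (complex \<Rightarrow> complex^'q^'q) \<Rightarrow>
   (complex \<Rightarrow> complex^'q^'p) \<Rightarrow> bool"
  where "twofold_EG_solution \<alpha> \<beta> \<gamma> \<delta> g \<longleftrightarrow>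
    g \<in> wiener_plus \<and>
    (\<lambda>\<zeta>. \<alpha> \<zeta> + g \<zeta> ** \<gamma> \<zeta> - mat 1) \<in> wiener_minus_0 \<and>
    (\<lambda>\<zeta>. (g \<zeta>)\<^sup>H ** \<alpha> \<zeta> + \<gamma> \<zeta>) \<in> wiener_plus_0 \<and>
    (\<lambda>\<zeta>. \<delta> \<zeta> + (g \<zeta>)\<^sup>H ** \<beta> \<zeta> - mat 1) \<in> wiener_plus_0 \<and>
    (\<lambda>\<zeta>. g \<zeta> ** \<delta> \<zeta> + \<beta> \<zeta>) \<in> wiener_minus_0"

text \<open>
  A block matrix with \<open>m + 1\<close> block rows and \<open>m + 1\<close> block columns is given by the function
  assigning to \<open>i, j \<le> m\<close> its \<open>(i, j)\<close> block; a block column is given by the function assigning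
  to \<open>i \<le> m\<close> its \<open>i\<close>-th block. Values at indices above \<open>m\<close> play no role.
  The inverse follows the pattern of the library's \<^const>\<open>matrix_inv\<close>.
\<close>

definition block_mult ::
  "nat \<Rightarrow> (nat \<Rightarrow> nat \<Rightarrow> complex^'n^'k) \<Rightarrow> (nat \<Rightarrow> nat \<Rightarrow> complex^'l^'n) \<Rightarrow> nat \<Rightarrow> nat \<Rightarrow> complex^'l^'k"
  where "block_mult m S T i j = (\<Sum>l\<le>m. S i l ** T l j)"

definition block_apply ::
  "nat \<Rightarrow> (nat \<Rightarrow> nat \<Rightarrow> complex^'n^'k) \<Rightarrow> (nat \<Rightarrow> complex^'l^'n) \<Rightarrow> nat \<Rightarrow> complex^'l^'k"
  where "block_apply m S v i = (\<Sum>l\<le>m. S i l ** v l)"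

definition block_inverses ::
  "nat \<Rightarrow> (nat \<Rightarrow> nat \<Rightarrow> complex^'n^'n) \<Rightarrow> (nat \<Rightarrow> nat \<Rightarrow> complex^'n^'n) \<Rightarrow> bool"
  where "block_inverses m S T \<longleftrightarrow>
    (\<forall>i\<le>m. \<forall>j\<le>m. block_mult m S T i j = (if i = j then mat 1 else 0) \<and>
                  block_mult m T S i j = (if i = j then mat 1 else 0))"

definition block_invertible :: "nat \<Rightarrow> (nat \<Rightarrow> nat \<Rightarrow> complex^'n^'n) \<Rightarrow> bool"
  where "block_invertible m S \<longleftrightarrow> (\<exists>T. block_inverses m S T)"

definition block_inv ::
  "nat \<Rightarrow> (nat \<Rightarrow> nat \<Rightarrow> complex^'n^'n) \<Rightarrow> nat \<Rightarrow> nat \<Rightarrow> complex^'n^'n"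
  where "block_inv m S = (SOME T. block_inverses m S T)"

definition toeplitz_b :: "nat \<Rightarrow> (nat \<Rightarrow> complex^'q^'p) \<Rightarrow> nat \<Rightarrow> nat \<Rightarrow> complex^'q^'p"
  where "toeplitz_b m b i j = (if i \<le> j then b (m + i - j) else 0)"

definition toeplitz_a_adj :: "(nat \<Rightarrow> complex^'p^'p) \<Rightarrow> nat \<Rightarrow> nat \<Rightarrow> complex^'p^'p"
  where "toeplitz_a_adj a i j = (if i \<le> j then (a (j - i))\<^sup>H else 0)"

definition toeplitz_d :: "(int \<Rightarrow> complex^'q^'q) \<Rightarrow> nat \<Rightarrow> nat \<Rightarrow> complex^'q^'q"
  where "toeplitz_d d i j = (if i \<le> j then d (int i - int j) else 0)"

end

theory Submission
  imports Defs
begin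

text \<open>
  Write \<open>X\<^sub>1, \<dots>, X\<^sub>4\<close> for the four functions in the definition of a solution, the second and
  third replaced by their adjoints, so that all four have only negative Fourier modes. The
  identities follow from a solution because, for example,
  \<open>\<alpha>\<^sup>*\<alpha> - \<gamma>\<^sup>*\<gamma> = \<alpha>\<^sup>*(X\<^sub>1 + I) - X\<^sub>2\<gamma>\<close> has no positive modes and is Hermitian, hence constant.
  They say that \<open>[\<alpha> \<beta>; \<gamma> \<delta>]\<close> is, up to constants, \<open>J\<close>-unitary on the circle, and the
  dual relations express \<open>g\<close> as \<open>\<alpha>a\<^sub>0\<^sup>-\<^sup>1X\<^sub>2 - \<beta>d\<^sub>0\<^sup>-\<^sup>1(X\<^sub>3 + I)\<close>, which has no modes above \<open>m\<close>.
  The coefficients of a polynomial \<open>g\<close> are then determined by triangular Toeplitz systems.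
\<close>

section \<open>Matrix algebra\<close>

text \<open>A solution \<open>g\<close> is a priori an infinite series, so finite systems for its
  coefficients are available only after the degree bound. Products of two infinite series are
  avoided throughout: in each product at least one factor has finite spectrum, a constant or one of
  the data, and the combinations of the four conditions are chosen so that the terms containing
  \<open>g\<close> cancel. Nothing assumes that \<alpha> or \<delta> is invertible on the circle,
  and no definiteness of \<open>a 0\<close> or \<open>d 0\<close> is available to force it.
  One-sidedness replaces pointwise invertibility: on the circle \<open>\<alpha>\<^sup>H\<close> and
  \<delta> are polynomials in the inverse of z with invertible constant term, so they can be
  cancelled by comparing coefficients from the top mode downwards, as soon as the other factor has a
  top mode. The same property makes the Toeplitz systems triangular with invertible diagonal.
  Existence starts from the second condition because, for a polynomial \<open>g\<close> of degree at
  most m, it amounts to exactly m + 1 block equations for the m + 1 unknown coefficients.\<close>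

lemma matrix_mult_add_rdistrib: "(A + B) ** C = A ** C + B ** (C :: complex^'l^'n)"
  by (simp add: matrix_matrix_mult_def vec_eq_iff sum.distrib algebra_simps)

lemma matrix_mult_diff_ldistrib: "A ** (B - C) = A ** B - A ** (C :: complex^'l^'n)"
  by (simp add: matrix_matrix_mult_def vec_eq_iff sum_subtractf algebra_simps)

lemma matrix_mult_diff_rdistrib: "(A - B) ** C = A ** C - B ** (C :: complex^'l^'n)"
  by (simp add: matrix_matrix_mult_def vec_eq_iff sum_subtractf algebra_simps)

lemma matrix_mult_minus_left: "(- A) ** B = - (A ** (B :: complex^'l^'n))"
  by (simp add: matrix_matrix_mult_def vec_eq_iff sum_negf)

lemma matrix_mult_minus_right: "A ** (- B) = - (A ** (B :: complex^'l^'n))"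
  by (simp add: matrix_matrix_mult_def vec_eq_iff sum_negf)

lemmas matrix_algebra =
  matrix_add_ldistrib matrix_mult_add_rdistrib matrix_mult_diff_ldistrib
  matrix_mult_diff_rdistrib matrix_mult_minus_left matrix_mult_minus_right

lemma matrix_mult_sum_left: "(\<Sum>i\<in>I. A i) ** B = (\<Sum>i\<in>I. A i ** (B :: complex^'l^'n))"
  by (induction I rule: infinite_finite_induct) (simp_all add: matrix_algebra)

lemma matrix_mult_sum_right: "A ** (\<Sum>i\<in>I. B i) = (\<Sum>i\<in>I. A ** (B i :: complex^'l^'n))"
  by (induction I rule: infinite_finite_induct) (simp_all add: matrix_algebra)

lemma mscale_mult_left: "(c *\<^sub>m A) ** B = c *\<^sub>m (A ** B)"
  by (simp add: mscale_def matrix_matrix_mult_def vec_eq_iff sum_distrib_left mult.assoc)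

lemma mscale_mult_right: "A ** (c *\<^sub>m B) = c *\<^sub>m (A ** B)"
  by (simp add: mscale_def matrix_matrix_mult_def vec_eq_iff sum_distrib_left mult_ac)

lemma mscale_mscale: "c *\<^sub>m d *\<^sub>m A = (c * d) *\<^sub>m A"
  by (simp add: mscale_def vec_eq_iff mult.assoc)

lemma mscale_add: "c *\<^sub>m (A + B) = c *\<^sub>m A + c *\<^sub>m B"
  by (simp add: mscale_def vec_eq_iff algebra_simps)

lemma mscale_minus: "c *\<^sub>m (- A) = - (c *\<^sub>m A)"
  by (simp add: mscale_def vec_eq_iff)

lemma mscale_zero [simp]: "c *\<^sub>m 0 = 0"
  by (simp add: mscale_def vec_eq_iff)

lemma mscale_one [simp]: "1 *\<^sub>m A = A"
  by (simp add: mscale_def vec_eq_iff)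

lemma linear_mscale: "linear (\<lambda>A :: complex^'n^'k. c *\<^sub>m A)"
  by (rule linearI) (simp_all add: mscale_def vec_eq_iff algebra_simps)

lemma linear_matrix_mult_left: "linear (\<lambda>B :: complex^'l^'n. A ** B)"
  by (rule linearI)
     (simp_all add: matrix_matrix_mult_def vec_eq_iff scaleR_sum_right sum.distrib algebra_simps)

lemma linear_matrix_mult_right: "linear (\<lambda>A :: complex^'n^'k. A ** (B :: complex^'l^'n))"
  by (rule linearI)
     (simp_all add: matrix_matrix_mult_def vec_eq_iff scaleR_sum_right sum.distrib algebra_simps)

lemma conj_transpose_mult: "(A ** B)\<^sup>H = B\<^sup>H ** A\<^sup>H"
  by (simp add: conj_transpose_def matrix_matrix_mult_def vec_eq_iff mult.commute)

lemma conj_transpose_invol [simp]: "(A\<^sup>H)\<^sup>H = A"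
  by (simp add: conj_transpose_def vec_eq_iff)

lemma conj_transpose_add: "(A + B)\<^sup>H = A\<^sup>H + B\<^sup>H"
  by (simp add: conj_transpose_def vec_eq_iff)

lemma conj_transpose_diff: "(A - B)\<^sup>H = A\<^sup>H - B\<^sup>H"
  by (simp add: conj_transpose_def vec_eq_iff)

lemma conj_transpose_minus: "(- A)\<^sup>H = - (A\<^sup>H)"
  by (simp add: conj_transpose_def vec_eq_iff)

lemma conj_transpose_zero [simp]: "0\<^sup>H = 0"
  by (simp add: conj_transpose_def vec_eq_iff)

lemma conj_transpose_mat_1 [simp]: "(mat 1)\<^sup>H = mat 1"
  by (simp add: conj_transpose_def vec_eq_iff mat_def)

lemma conj_transpose_mscale: "(c *\<^sub>m A)\<^sup>H = cnj c *\<^sub>m A\<^sup>H"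
  by (simp add: conj_transpose_def mscale_def vec_eq_iff)

lemma conj_transpose_sum: "(\<Sum>i\<in>I. A i)\<^sup>H = (\<Sum>i\<in>I. (A i)\<^sup>H)"
  by (induction I rule: infinite_finite_induct) (simp_all add: conj_transpose_add)

lemmas conj_transpose_algebra =
  conj_transpose_add conj_transpose_diff conj_transpose_minus conj_transpose_mult

lemma linear_conj_transpose: "linear (\<lambda>A :: complex^'n^'k. A\<^sup>H)"
  by (rule linearI) (simp_all add: conj_transpose_def vec_eq_iff)

lemma invertible_conj_transpose:
  assumes "invertible (A :: complex^'n^'n)" shows "invertible (A\<^sup>H)"
proof -
  obtain B where "A ** B = mat 1" "B ** A = mat 1"
    using assms by (auto simp: invertible_def)
  then have "B\<^sup>H ** A\<^sup>H = mat 1" "A\<^sup>H ** B\<^sup>H = mat 1"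
    by (simp_all flip: conj_transpose_mult)
  then show ?thesis by (auto simp: invertible_def)
qed

lemma invertible_mult_left_eq_0:
  assumes "invertible (A :: complex^'n^'n)" "A ** B = 0" shows "B = 0"
proof -
  obtain A' where "A' ** A = mat 1" using assms(1) by (auto simp: invertible_def)
  then have "B = A' ** (A ** B)" by (simp add: matrix_mul_assoc)
  with assms(2) show ?thesis by simp
qed

lemma invertible_mult_right_eq_0:
  assumes "invertible (A :: complex^'n^'n)" "B ** A = 0" shows "B = 0"
proof -
  obtain A' where "A ** A' = mat 1" using assms(1) by (auto simp: invertible_def)
  then have "B = B ** A ** A'" by (simp flip: matrix_mul_assoc)
  with assms(2) show ?thesis by simp
qed

text \<open>
  The hypotheses say that \<open>M = [\<alpha> \<beta>; \<gamma> \<delta>]\<close> satisfies \<open>M\<^sup>H J M = diag a (- d)\<close> with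
  \<open>J = diag I (- I)\<close>; the conclusions are two blocks of \<open>M diag (a\<^sup>-\<^sup>1) (- d\<^sup>-\<^sup>1) M\<^sup>H J = I\<close>.
\<close>

lemma J_unitary_dual:
  fixes \<alpha> a a' :: "complex^'p^'p" and \<beta> :: "complex^'q^'p"
    and \<gamma> :: "complex^'p^'q" and \<delta> d d' :: "complex^'q^'q"
  assumes a: "\<alpha>\<^sup>H ** \<alpha> - \<gamma>\<^sup>H ** \<gamma> = a" and d: "\<delta>\<^sup>H ** \<delta> - \<beta>\<^sup>H ** \<beta> = d"
    and od: "\<alpha>\<^sup>H ** \<beta> = \<gamma>\<^sup>H ** \<delta>"
    and a': "a' ** a = mat 1" and d': "d' ** d = mat 1"
  shows "\<alpha> ** a' ** \<alpha>\<^sup>H - \<beta> ** d' ** \<beta>\<^sup>H = mat 1"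
    and "\<alpha> ** a' ** \<gamma>\<^sup>H = \<beta> ** d' ** \<delta>\<^sup>H"
proof -
  have od': "\<beta>\<^sup>H ** \<alpha> = \<delta>\<^sup>H ** \<gamma>"
    using arg_cong[OF od, of conj_transpose] by (simp add: conj_transpose_mult)
  \<comment> \<open>The operator of M on pairs. The next two facts say that it has a left inverse
    built from \<open>a'\<close>, \<open>d'\<close> and the adjoint of M; finite dimension then
    turns injectivity into surjectivity, which is where the dual relations come from.\<close>
  define f where "f = (\<lambda>(x, y). (\<alpha> *v x + \<beta> *v y, \<gamma> *v x + \<delta> *v y))"
  have ax: "a *v x = \<alpha>\<^sup>H *v fst (f (x, y)) - \<gamma>\<^sup>H *v snd (f (x, y))" for x y
    by (simp add: f_def algebra_simps matrix_vector_mul_assoc od flip: a)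
  have dy: "d *v y = \<delta>\<^sup>H *v snd (f (x, y)) - \<beta>\<^sup>H *v fst (f (x, y))" for x y
    by (simp add: f_def algebra_simps matrix_vector_mul_assoc od' flip: d)
  have x_eq: "x = a' *v (a *v x)" and y_eq: "y = d' *v (d *v y)" for x y
    by (simp_all add: matrix_vector_mul_assoc a' d')
  have "linear f"
    by (rule linearI) (auto simp: f_def algebra_simps linear_scale[OF matrix_vector_mul_linear])
  moreover have "inj f"
  proof (unfold linear_injective_0[OF \<open>linear f\<close>], clarify)
    fix x y assume "f (x, y) = 0"
    then have "a *v x = 0" "d *v y = 0" by (simp_all add: ax[of x y] dy[of y x])
    then show "(x, y) = 0" using x_eq[of x] y_eq[of y] by (simp add: zero_prod_def)
  qed
  ultimately have surj: "surj f"
    by (rule linear_inj_imp_surj)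
  show "\<alpha> ** a' ** \<alpha>\<^sup>H - \<beta> ** d' ** \<beta>\<^sup>H = mat 1"
  proof (subst matrix_eq, rule allI)
    fix u
    \<comment> \<open>Inputs whose image has second component zero isolate the first block column of
      the dual relation; images with first component zero isolate the second column below.\<close>
    obtain x y where xy: "f (x, y) = (u, 0)" using surj by (metis surjD surj_pair)
    have "\<alpha>\<^sup>H *v u = a *v x" "\<beta>\<^sup>H *v u = - (d *v y)"
      using ax[of x y] dy[of y x] by (simp_all add: xy)
    then have "(\<alpha> ** a' ** \<alpha>\<^sup>H - \<beta> ** d' ** \<beta>\<^sup>H) *v u = \<alpha> *v (a' *v (a *v x)) + \<beta> *v (d' *v (d *v y))"
      by (simp add: matrix_vector_mult_diff_rdistrib linear_neg[OF matrix_vector_mul_linear]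
          flip: matrix_vector_mul_assoc)
    also have "\<dots> = \<alpha> *v x + \<beta> *v y" by (simp flip: x_eq y_eq)
    also have "\<dots> = mat 1 *v u" using xy by (simp add: f_def)
    finally show "(\<alpha> ** a' ** \<alpha>\<^sup>H - \<beta> ** d' ** \<beta>\<^sup>H) *v u = mat 1 *v u" .
  qed
  show "\<alpha> ** a' ** \<gamma>\<^sup>H = \<beta> ** d' ** \<delta>\<^sup>H"
  proof (subst matrix_eq, rule allI)
    fix v
    obtain x y where xy: "f (x, y) = (0, v)" using surj by (metis surjD surj_pair)
    have \<gamma>v: "\<gamma>\<^sup>H *v v = - (a *v x)" and \<delta>v: "\<delta>\<^sup>H *v v = d *v y"
      using ax[of x y] dy[of y x] by (simp_all add: xy)
    have "(\<alpha> ** a' ** \<gamma>\<^sup>H) *v v = - (\<alpha> *v (a' *v (a *v x)))"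
      by (simp add: \<gamma>v linear_neg[OF matrix_vector_mul_linear] flip: matrix_vector_mul_assoc)
    also have "\<dots> = - (\<alpha> *v x)" by (simp flip: x_eq)
    also have "\<dots> = \<beta> *v y" using xy by (simp add: f_def add_eq_0_iff)
    also have "\<dots> = \<beta> *v (d' *v (d *v y))" by (simp flip: y_eq)
    also have "\<dots> = (\<beta> ** d' ** \<delta>\<^sup>H) *v v"
      by (simp add: \<delta>v flip: matrix_vector_mul_assoc)
    finally show "(\<alpha> ** a' ** \<gamma>\<^sup>H) *v v = (\<beta> ** d' ** \<delta>\<^sup>H) *v v" .
  qed
qed

section \<open>Triangular block Toeplitz systems\<close>

text \<open>The block s k fills the k-th superdiagonal, so these matrices multiply like power series
  truncated after degree m.\<close>

definition upper_toeplitz :: "(nat \<Rightarrow> complex^'n^'k) \<Rightarrow> nat \<Rightarrow> nat \<Rightarrow> complex^'n^'k"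
  where "upper_toeplitz s i j = (if i \<le> j then s (j - i) else 0)"

lemma toeplitz_d_eq: "toeplitz_d d = upper_toeplitz (\<lambda>k. d (- int k))"
  by (auto simp: toeplitz_d_def upper_toeplitz_def fun_eq_iff of_nat_diff)

lemma toeplitz_a_adj_eq: "toeplitz_a_adj a = upper_toeplitz (\<lambda>k. (a k)\<^sup>H)"
  by (simp add: toeplitz_a_adj_def upper_toeplitz_def fun_eq_iff)

lemma block_mult_upper_toeplitz:
  assumes "j \<le> m"
  shows "block_mult m (upper_toeplitz s) (upper_toeplitz t) i j =
    (if i \<le> j then \<Sum>k\<le>j - i. s k ** t (j - i - k) else 0)"
proof -
  have "block_mult m (upper_toeplitz s) (upper_toeplitz t) i j = (\<Sum>l\<in>{i..j}. s (l - i) ** t (j - l))"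
    unfolding block_mult_def
    by (rule sum.mono_neutral_cong_right) (use assms in \<open>auto simp: upper_toeplitz_def\<close>)
  also have "\<dots> = (if i \<le> j then \<Sum>k\<le>j - i. s k ** t (j - i - k) else 0)"
    by (auto intro!: sum.reindex_bij_witness[of _ "\<lambda>k. k + i" "\<lambda>l. l - i"])
  finally show ?thesis .
qed

text \<open>The reciprocal of a power series is built one coefficient at a time. The value
  \<open>t 0\<close> is kept in the conclusion so that the construction can be applied again to
  \<open>t\<close>.\<close>

lemma convolution_right_inverse:
  fixes s :: "nat \<Rightarrow> complex^'n^'n"
  assumes "s 0 ** s' = mat 1"
  shows "\<exists>t. t 0 = s' \<and> (\<forall>n\<le>m. (\<Sum>k\<le>n. s k ** t (n - k)) = (if n = 0 then mat 1 else 0))"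
proof (induction m)
  case 0
  show ?case using assms by (intro exI[of _ "\<lambda>_. s'"]) simp
next
  case (Suc m)
  then obtain t where t0: "t 0 = s'"
    and t: "\<And>n. n \<le> m \<Longrightarrow> (\<Sum>k\<le>n. s k ** t (n - k)) = (if n = 0 then mat 1 else 0)" by blast
  \<comment> \<open>The new coefficient solves the equation of degree \<open>Suc m\<close>, in which
    it occurs only with the factor \<open>s 0\<close>. The equations of lower degree involve no
    entry beyond m and are unchanged.\<close>
  define t' where "t' = t(Suc m := - (s' ** (\<Sum>k\<le>m. s (Suc k) ** t (m - k))))"
  have "(\<Sum>k\<le>n. s k ** t' (n - k)) = (\<Sum>k\<le>n. s k ** t (n - k))" if "n \<le> m" for n
    using that by (intro sum.cong) (auto simp: t'_def)
  moreover have "(\<Sum>k\<le>Suc m. s k ** t' (Suc m - k)) = 0"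
  proof -
    have "(\<Sum>k\<le>m. s (Suc k) ** t' (m - k)) = (\<Sum>k\<le>m. s (Suc k) ** t (m - k))"
      by (intro sum.cong) (auto simp: t'_def)
    then show ?thesis
      by (subst sum.atMost_Suc_shift)
         (simp add: t'_def matrix_mult_minus_right matrix_mul_assoc assms)
  qed
  ultimately have "(\<Sum>k\<le>n. s k ** t' (n - k)) = (if n = 0 then mat 1 else 0)" if "n \<le> Suc m" for n
    using that t by (cases "n = Suc m") (simp_all add: le_Suc_eq)
  then show ?case using t0 by (intro exI[of _ t']) (simp add: t'_def)
qed

lemma upper_toeplitz_right_inverse:
  fixes s :: "nat \<Rightarrow> complex^'n^'n"
  assumes "s 0 ** s' = mat 1"
  shows "\<exists>t. t 0 = s' \<and> (\<forall>i\<le>m. \<forall>j\<le>m.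
    block_mult m (upper_toeplitz s) (upper_toeplitz t) i j = (if i = j then mat 1 else 0))"
proof -
  obtain t where "t 0 = s'"
    and t: "\<And>n. n \<le> m \<Longrightarrow> (\<Sum>k\<le>n. s k ** t (n - k)) = (if n = 0 then mat 1 else 0)"
    using convolution_right_inverse[of s s' m] assms by blast
  moreover have "block_mult m (upper_toeplitz s) (upper_toeplitz t) i j = (if i = j then mat 1 else 0)"
    if "i \<le> m" "j \<le> m" for i j
    using that t[of "j - i"] by (cases "j < i") (simp_all add: block_mult_upper_toeplitz del: diff_diff_left)
  ultimately show ?thesis by blast
qed

section \<open>Associativity and inverses of block matrices\<close>

lemma block_mult_assoc:
  "block_mult m (block_mult m S T) U i j = block_mult m S (block_mult m T U) i j"
proof -
  have "block_mult m (block_mult m S T) U i j = (\<Sum>l\<le>m. \<Sum>k\<le>m. S i k ** T k l ** U l j)"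
    by (simp add: block_mult_def matrix_mult_sum_left)
  also have "\<dots> = block_mult m S (block_mult m T U) i j"
    by (subst sum.swap) (simp add: block_mult_def matrix_mult_sum_right matrix_mul_assoc)
  finally show ?thesis .
qed

lemma block_mult_apply: "block_apply m (block_mult m S T) v i = block_apply m S (block_apply m T v) i"
proof -
  have "block_apply m (block_mult m S T) v i = (\<Sum>l\<le>m. \<Sum>k\<le>m. S i k ** T k l ** v l)"
    by (simp add: block_mult_def block_apply_def matrix_mult_sum_left)
  also have "\<dots> = block_apply m S (block_apply m T v) i"
    by (subst sum.swap) (simp add: block_apply_def matrix_mult_sum_right matrix_mul_assoc)
  finally show ?thesis .
qed

lemma block_apply_cong:
  "(\<And>l. l \<le> m \<Longrightarrow> S i l = S' i l) \<Longrightarrow> (\<And>l. l \<le> m \<Longrightarrow> v l = v' l) \<Longrightarrow>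
    block_apply m S v i = block_apply m S' v' i"
  unfolding block_apply_def by (intro sum.cong) auto

lemma block_mult_cong:
  "(\<And>l. l \<le> m \<Longrightarrow> S i l = S' i l) \<Longrightarrow> (\<And>l. l \<le> m \<Longrightarrow> T l j = T' l j) \<Longrightarrow>
    block_mult m S T i j = block_mult m S' T' i j"
  unfolding block_mult_def by (intro sum.cong) auto

lemma sum_mat_1_left:
  "i \<le> (m :: nat) \<Longrightarrow> (\<Sum>l\<le>m. (if i = l then mat 1 else 0) ** v l) = (v i :: complex^'l^'n)"
  by (simp add: if_distrib[of "\<lambda>A. A ** _"] if_distribR cong: if_cong)

lemma sum_mat_1_right:
  "i \<le> (m :: nat) \<Longrightarrow> (\<Sum>l\<le>m. v l ** (if l = i then mat 1 else 0)) = (v i :: complex^'n^'l)"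
  by (simp add: if_distrib[of "\<lambda>A. _ ** A"] if_distribR cong: if_cong)

text \<open>A right inverse T that itself has a right inverse U is two-sided: S = S(TU) = (ST)U = U,
  hence TS = TU = I. The diagonal block of T is \<open>s'\<close>, which has the right inverse
  \<open>s 0\<close>, so U exists by the same construction.\<close>

lemma block_invertible_upper_toeplitz:
  fixes s :: "nat \<Rightarrow> complex^'n^'n"
  assumes "invertible (s 0)"
  shows "block_invertible m (upper_toeplitz s)"
proof -
  obtain s' where s': "s 0 ** s' = mat 1" "s' ** s 0 = mat 1"
    using assms by (auto simp: invertible_def)
  obtain t where t0: "t 0 = s'" and t: "\<And>i j. i \<le> m \<Longrightarrow> j \<le> m \<Longrightarrow>
      block_mult m (upper_toeplitz s) (upper_toeplitz t) i j = (if i = j then mat 1 else 0)"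
    using upper_toeplitz_right_inverse[of s s' m] s'(1) by blast
  have "t 0 ** s 0 = mat 1" using s'(2) by (simp add: t0)
  then obtain u where u: "\<And>i j. i \<le> m \<Longrightarrow> j \<le> m \<Longrightarrow>
      block_mult m (upper_toeplitz t) (upper_toeplitz u) i j = (if i = j then mat 1 else 0)"
    using upper_toeplitz_right_inverse[of t "s 0" m] by blast
  let ?S = "upper_toeplitz s" and ?T = "upper_toeplitz t" and ?U = "upper_toeplitz u"
  let ?I = "\<lambda>i j. if i = j then mat 1 else 0 :: complex^'n^'n"
  have "?S i j = ?U i j" if "i \<le> m" "j \<le> m" for i j
  proof -
    have "?S i j = block_mult m ?S ?I i j"
      using that by (simp add: block_mult_def sum_mat_1_right)
    also have "\<dots> = block_mult m ?S (block_mult m ?T ?U) i j"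
      by (intro block_mult_cong) (simp_all add: u that)
    also have "\<dots> = block_mult m ?I ?U i j"
      unfolding block_mult_assoc[symmetric] by (intro block_mult_cong) (simp_all add: t that)
    also have "\<dots> = ?U i j"
      using that by (simp add: block_mult_def sum_mat_1_left)
    finally show ?thesis .
  qed
  then have "block_mult m ?T ?S i j = ?I i j" if "i \<le> m" "j \<le> m" for i j
    unfolding u[OF that, symmetric] by (intro block_mult_cong) (simp_all add: that)
  then show ?thesis
    using t by (auto simp: block_invertible_def block_inverses_def intro!: exI[of _ ?T])
qed

lemma block_inverses_block_inv: "block_invertible m S \<Longrightarrow> block_inverses m S (block_inv m S)"
  unfolding block_invertible_def block_inv_def by (metis someI_ex)

lemma block_apply_block_inv_right:
  assumes "block_invertible m S" "i \<le> m"
  shows "block_apply m S (block_apply m (block_inv m S) v) i = v i"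
proof -
  have "block_apply m S (block_apply m (block_inv m S) v) i =
      block_apply m (\<lambda>i j. if i = j then mat 1 else 0) v i"
    using block_inverses_block_inv[OF assms(1)] assms(2)
    by (subst block_mult_apply[symmetric]) (auto simp: block_inverses_def intro!: block_apply_cong)
  then show ?thesis using assms(2) by (simp add: block_apply_def sum_mat_1_left)
qed

lemma block_apply_block_inv_left:
  assumes "block_invertible m S" "i \<le> m"
  shows "block_apply m (block_inv m S) (block_apply m S v) i = v i"
proof -
  have "block_apply m (block_inv m S) (block_apply m S v) i =
      block_apply m (\<lambda>i j. if i = j then mat 1 else 0) v i"
    using block_inverses_block_inv[OF assms(1)] assms(2)
    by (subst block_mult_apply[symmetric]) (auto simp: block_inverses_def intro!: block_apply_cong)
  then show ?thesis using assms(2) by (simp add: block_apply_def sum_mat_1_left)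
qed

lemma block_apply_minus: "block_apply m S (\<lambda>k. - v k) i = - block_apply m S v i"
  by (simp add: block_apply_def matrix_mult_minus_right sum_negf)

text \<open>Since \<open>x\<close> vanishes above N, the equation at the highest index in question
  contains only its term j = 0, and \<open>L 0\<close> has trivial kernel. \<open>L\<close> is
  abstract so that left multiplication by \<open>(a j)\<^sup>H\<close> and right multiplication by
  \<open>d (- int j)\<close> are both instances.\<close>

lemma back_substitution:
  fixes x :: "int \<Rightarrow> 'a :: comm_monoid_add" and L :: "nat \<Rightarrow> 'a \<Rightarrow> 'a"
  assumes bounded: "\<And>\<nu>. \<nu> > N \<Longrightarrow> x \<nu> = 0"
    and eq: "\<And>\<nu>. \<nu> \<ge> 0 \<Longrightarrow> (\<Sum>j\<le>m. L j (x (\<nu> + int j))) = 0"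
    and L: "\<And>j. L j 0 = 0" "\<And>y. L 0 y = 0 \<Longrightarrow> y = 0"
    and "\<nu> \<ge> 0"
  shows "x \<nu> = 0"
  using \<open>\<nu> \<ge> 0\<close>
\<comment> \<open>The measure decreases as the index grows, so the induction runs downwards from
  N.\<close>
proof (induction "nat (N + 1 - \<nu>)" arbitrary: \<nu> rule: less_induct)
  case less
  show ?case
  proof (cases "\<nu> > N")
    case True
    then show ?thesis by (rule bounded)
  next
    case False
    have "x (\<nu> + int j) = 0" if "j \<noteq> 0" for j
      using less that False by (intro less) auto
    then have "(\<Sum>j\<le>m. L j (x (\<nu> + int j))) = (\<Sum>j\<in>{0}. L j (x (\<nu> + int j)))"
      by (intro sum.mono_neutral_right) (auto simp: L)
    then show ?thesis using eq[OF less.prems] L(2) by simp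
  qed
qed

section \<open>Wiener series\<close>

lemma cnj_powi_sphere:
  assumes "z \<in> sphere 0 1" shows "cnj z powi \<nu> = z powi (- \<nu>)"
proof -
  have "z * cnj z = 1" using assms by (simp add: complex_norm_square[symmetric])
  then have "cnj z = inverse z" by (metis inverse_unique)
  then show ?thesis by (simp add: power_int_inverse power_int_minus)
qed

lemma has_integral_cis_int:
  "((\<lambda>t. cis (of_int n * t)) has_integral (if n = 0 then 2 * of_real pi else 0)) {0..2 * pi}"
proof (cases "n = 0")
  case True
  then show ?thesis using has_integral_const_real[of "1 :: complex" 0 "2 * pi"] by (simp add: scaleR_conv_of_real)
next
  case False
  have "((\<lambda>t. cis (of_int n * t)) has_integral
      cis (of_int n * (2 * pi)) / (\<i> * of_int n) - cis (of_int n * 0) / (\<i> * of_int n)) {0..2 * pi}"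
  proof (rule fundamental_theorem_of_calculus)
    fix t :: real
    show "((\<lambda>t. cis (of_int n * t) / (\<i> * of_int n)) has_vector_derivative cis (of_int n * t))
        (at t within {0..2 * pi})"
      unfolding cis_conv_exp of_real_mult
      by (rule has_vector_derivative_real_field, (rule derivative_eq_intros refl)+)
         (use False in \<open>simp_all add: mult.left_commute[of \<i>]\<close>)
  qed simp
  moreover have "cis (of_int n * (2 * pi)) = 1"
    using cis_multiple_2pi[of "of_int n"] by (simp add: mult_ac)
  ultimately show ?thesis using False by simp
qed

text \<open>Absolute summability makes the partial sums small uniformly on the circle. Integrating
  one finite partial sum against the k-th character then bounds the coefficient, without exchanging
  an integral with an infinite sum.\<close>

lemma fourier_coefficients_unique:
  fixes x :: "int \<Rightarrow> complex"
  assumes summable: "(\<lambda>\<nu>. norm (x \<nu>)) summable_on UNIV"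
    and zero: "\<And>z. z \<in> sphere 0 1 \<Longrightarrow> ((\<lambda>\<nu>. z powi \<nu> * x \<nu>) has_sum 0) UNIV"
  shows "x k = 0"
proof (rule ccontr)
  assume "x k \<noteq> 0"
  have "uniform_limit (sphere 0 1) (\<lambda>F z. \<Sum>\<nu>\<in>F. z powi \<nu> * x \<nu>) (\<lambda>_. 0) (finite_subsets_at_top UNIV)"
    using zero by (intro Weierstrass_m_test_general'[OF _ _ summable])
      (auto simp: norm_mult norm_power_int)
  then have "\<forall>\<^sub>F F in finite_subsets_at_top UNIV.
      \<forall>z\<in>sphere 0 1. norm (\<Sum>\<nu>\<in>F. z powi \<nu> * x \<nu>) < norm (x k) / 2"
    using \<open>x k \<noteq> 0\<close> by (auto simp: uniform_limit_iff dest!: spec[of _ "norm (x k) / 2"])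
  then obtain F0 where F0: "finite F0 \<and> F0 \<subseteq> UNIV \<and> (\<forall>F. finite F \<and> F0 \<subseteq> F \<and> F \<subseteq> UNIV \<longrightarrow>
      (\<forall>z\<in>sphere 0 1. norm (\<Sum>\<nu>\<in>F. z powi \<nu> * x \<nu>) < norm (x k) / 2))"
    unfolding eventually_finite_subsets_at_top by (rule exE)
  \<comment> \<open>The index k must occur in the partial sum, or the integral would not see its
    coefficient.\<close>
  define F where "F = insert k F0"
  have "finite F" using F0 by (simp add: F_def)
  have "((\<lambda>t. \<Sum>\<nu>\<in>F. cis (of_int (\<nu> - k) * t) * x \<nu>) has_integral
      (\<Sum>\<nu>\<in>F. (if \<nu> - k = 0 then 2 * of_real pi else 0) * x \<nu>)) {0..2 * pi}"
    by (intro has_integral_sum has_integral_mult_left has_integral_cis_int \<open>finite F\<close>)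
  also have "(\<Sum>\<nu>\<in>F. (if \<nu> - k = 0 then 2 * of_real pi else 0) * x \<nu>) =
      (\<Sum>\<nu>\<in>F. if \<nu> = k then 2 * of_real pi * x k else 0)"
    by (intro sum.cong) auto
  also have "\<dots> = 2 * of_real pi * x k"
    using \<open>finite F\<close> by (simp add: F_def)
  \<comment> \<open>The interval has length 2 pi, so this bounds the norm of \<open>x k\<close> by
    half of itself.\<close>
  finally have "norm (2 * of_real pi * x k) \<le> norm (x k) / 2 * measure lborel (cbox 0 (2 * pi))"
  proof (intro has_integral_bound)
    fix t :: real
    have "(\<Sum>\<nu>\<in>F. cis (of_int (\<nu> - k) * t) * x \<nu>) = cis (- of_int k * t) * (\<Sum>\<nu>\<in>F. cis t powi \<nu> * x \<nu>)"
      unfolding sum_distrib_left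
      by (intro sum.cong) (simp_all add: cis_power_int cis_mult ring_distribs flip: mult.assoc)
    then show "norm (\<Sum>\<nu>\<in>F. cis (of_int (\<nu> - k) * t) * x \<nu>) \<le> norm (x k) / 2"
      using F0[THEN conjunct2, THEN conjunct2, rule_format, of F "cis t"] \<open>finite F\<close>
      by (simp add: norm_mult F_def subset_insertI less_imp_le)
  qed simp_all
  then show False using \<open>x k \<noteq> 0\<close> by (simp add: norm_mult)
qed

lemma wiener_series_cong:
  "(\<And>z. z \<in> sphere 0 1 \<Longrightarrow> \<rho> z = \<sigma> z) \<Longrightarrow> wiener_series r \<rho> \<longleftrightarrow> wiener_series r \<sigma>"
  by (auto simp: wiener_series_def)

text \<open>One lemma for multiplication by a constant matrix on either side, by a power of z, and
  by -1. \<open>linear\<close> is real linearity, hence the separate hypothesis that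
  \<open>T\<close> commutes with complex scalars.\<close>

lemma wiener_series_linear_shift:
  fixes T :: "complex^'n^'k \<Rightarrow> complex^'l^'j"
  assumes \<rho>: "wiener_series r \<rho>"
    and T: "linear T" "\<And>c A. T (c *\<^sub>m A) = c *\<^sub>m T A"
  shows "wiener_series (\<lambda>\<nu>. T (r (\<nu> - k))) (\<lambda>z. z powi k *\<^sub>m T (\<rho> z))"
  unfolding wiener_series_def
proof (intro conjI ballI)
  obtain K where K: "\<And>A. norm (T A) \<le> norm A * K"
    using linear_conv_bounded_linear[of T] T(1) bounded_linear.bounded by blast
  have "(\<lambda>\<nu>. norm (r (\<nu> - k))) summable_on UNIV \<longleftrightarrow> (\<lambda>\<nu>. norm (r \<nu>)) summable_on UNIV"
    by (rule summable_on_reindex_bij_witness[of _ "\<lambda>\<nu>. \<nu> + k" "\<lambda>\<nu>. \<nu> - k"]) auto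
  with \<rho> have "(\<lambda>\<nu>. norm (r (\<nu> - k)) * K) summable_on UNIV"
    by (intro summable_on_cmult_left) (simp add: wiener_series_def)
  then show "(\<lambda>\<nu>. norm (T (r (\<nu> - k)))) summable_on UNIV"
    by (rule Infinite_Sum.abs_summable_on_comparison_test') (rule K)
next
  fix z :: complex assume z: "z \<in> sphere 0 1"
  then have "z \<noteq> 0" by auto
  have "((\<lambda>\<nu>. z powi \<nu> *\<^sub>m r \<nu>) has_sum \<rho> z) UNIV"
    using \<rho> z by (simp add: wiener_series_def)
  moreover have "bounded_linear (\<lambda>A. z powi k *\<^sub>m T A)"
    using linear_compose[OF T(1) linear_mscale[of "z powi k"]]
    by (simp only: o_def linear_conv_bounded_linear)
  ultimately have "((\<lambda>\<nu>. z powi k *\<^sub>m T (z powi \<nu> *\<^sub>m r \<nu>)) has_sum z powi k *\<^sub>m T (\<rho> z)) UNIV"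
    by (rule has_sum_bounded_linear[rotated])
  then show "((\<lambda>\<nu>. z powi \<nu> *\<^sub>m T (r (\<nu> - k))) has_sum z powi k *\<^sub>m T (\<rho> z)) UNIV"
    by (subst has_sum_reindex_bij_witness[of _ "\<lambda>\<nu>. \<nu> + k" "\<lambda>\<nu>. \<nu> - k"])
       (auto simp: T(2) mscale_mscale power_int_add[symmetric] \<open>z \<noteq> 0\<close>)
qed

lemma wiener_series_add:
  assumes "wiener_series r \<rho>" "wiener_series s \<sigma>"
  shows "wiener_series (\<lambda>\<nu>. r \<nu> + s \<nu>) (\<lambda>z. \<rho> z + \<sigma> z)"
  unfolding wiener_series_def
proof (intro conjI ballI)
  show "(\<lambda>\<nu>. norm (r \<nu> + s \<nu>)) summable_on UNIV"
    using assms
    by (intro Infinite_Sum.abs_summable_on_comparison_test'[of "\<lambda>\<nu>. norm (r \<nu>) + norm (s \<nu>)"])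
       (simp_all add: wiener_series_def summable_on_add norm_triangle_ineq)
qed (use assms in \<open>auto simp: wiener_series_def mscale_add intro!: has_sum_add\<close>)

lemma wiener_series_minus:
  assumes "wiener_series r \<rho>" shows "wiener_series (\<lambda>\<nu>. - r \<nu>) (\<lambda>z. - \<rho> z)"
  using wiener_series_linear_shift[OF assms, of uminus 0]
  by (simp add: linear_iff mscale_minus)

lemma wiener_series_diff:
  assumes "wiener_series r \<rho>" "wiener_series s \<sigma>"
  shows "wiener_series (\<lambda>\<nu>. r \<nu> - s \<nu>) (\<lambda>z. \<rho> z - \<sigma> z)"
  using wiener_series_add[OF assms(1) wiener_series_minus[OF assms(2)]] by simp

lemma wiener_series_zero: "wiener_series (\<lambda>_. 0) (\<lambda>_. 0)"
  by (simp add: wiener_series_def)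

lemma wiener_series_sum:
  assumes "\<And>i. i \<in> I \<Longrightarrow> wiener_series (r i) (\<rho> i)"
  shows "wiener_series (\<lambda>\<nu>. \<Sum>i\<in>I. r i \<nu>) (\<lambda>z. \<Sum>i\<in>I. \<rho> i z)"
  using assms
  by (induction I rule: infinite_finite_induct)
     (simp_all add: wiener_series_zero wiener_series_add)

lemma wiener_series_const: "wiener_series (\<lambda>\<nu>. if \<nu> = 0 then A else 0) (\<lambda>_. A)"
  unfolding wiener_series_def
proof (intro conjI ballI)
  show "(\<lambda>\<nu> :: int. norm (if \<nu> = 0 then A else 0)) summable_on UNIV"
    by (rule summable_on_cong_neutral[THEN iffD2, OF _ _ _ summable_on_finite[of "{0}"]]) auto
  show "((\<lambda>\<nu>. z powi \<nu> *\<^sub>m (if \<nu> = 0 then A else 0)) has_sum A) UNIV" for z :: complex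
    by (rule has_sum_finite_neutralI[of "{0}"]) auto
qed

text \<open>Each monomial of the polynomial factor contributes a shift by its exponent, so the
  convolution is a finite sum.\<close>

lemma wiener_series_mult_left:
  assumes "wiener_series r \<rho>"
  shows "wiener_series (\<lambda>\<nu>. \<Sum>i\<in>I. A i ** r (\<nu> - k i)) (\<lambda>z. (\<Sum>i\<in>I. z powi k i *\<^sub>m A i) ** \<rho> z)"
  unfolding matrix_mult_sum_left mscale_mult_left
  by (intro wiener_series_sum wiener_series_linear_shift assms linear_matrix_mult_left mscale_mult_right)

lemma wiener_series_mult_right:
  assumes "wiener_series r \<rho>"
  shows "wiener_series (\<lambda>\<nu>. \<Sum>i\<in>I. r (\<nu> - k i) ** A i) (\<lambda>z. \<rho> z ** (\<Sum>i\<in>I. z powi k i *\<^sub>m A i))"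
  unfolding matrix_mult_sum_right mscale_mult_right
  by (intro wiener_series_sum wiener_series_linear_shift[where T = "\<lambda>B. B ** _"] assms
      linear_matrix_mult_right mscale_mult_left)

lemma wiener_series_laurent_polynomial:
  "wiener_series (\<lambda>\<nu>. \<Sum>i\<in>I. if \<nu> = k i then A i else 0) (\<lambda>z. \<Sum>i\<in>I. z powi k i *\<^sub>m A i)"
proof -
  have "(\<lambda>\<nu>. \<Sum>i\<in>I. A i ** (if \<nu> - k i = 0 then mat 1 else 0)) =
      (\<lambda>\<nu>. \<Sum>i\<in>I. if \<nu> = k i then A i else 0)"
    by (intro ext sum.cong) auto
  then show ?thesis
    using wiener_series_mult_left[OF wiener_series_const[of "mat 1"], of A k I] by simp
qed

text \<open>Conjugation inverts z on the circle and so reverses the coefficient sequence. The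
  adjoint is conjugate linear, which keeps it out of reach of
  \<open>wiener_series_linear_shift\<close>.\<close>

lemma wiener_series_conj_transpose:
  fixes r :: "int \<Rightarrow> complex^'n^'k"
  assumes "wiener_series r \<rho>"
  shows "wiener_series (\<lambda>\<nu>. (r (- \<nu>))\<^sup>H) (\<lambda>z. (\<rho> z)\<^sup>H)"
  unfolding wiener_series_def
proof (intro conjI ballI)
  have "(\<lambda>\<nu>. norm (r (- \<nu>))) summable_on UNIV \<longleftrightarrow> (\<lambda>\<nu>. norm (r \<nu>)) summable_on UNIV"
    by (rule summable_on_reindex_bij_witness[of _ uminus uminus]) auto
  moreover have "norm (A\<^sup>H) = norm A" for A :: "complex^'n^'k"
  proof -
    have "norm (A\<^sup>H) = sqrt (\<Sum>i\<in>UNIV. \<Sum>j\<in>UNIV. (norm (A $ j $ i))\<^sup>2)"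
      by (simp add: norm_vec_def L2_set_def conj_transpose_def sum_nonneg)
    also have "\<dots> = norm A"
      by (subst sum.swap) (simp add: norm_vec_def L2_set_def sum_nonneg)
    finally show ?thesis .
  qed
  ultimately show "(\<lambda>\<nu>. norm ((r (- \<nu>))\<^sup>H)) summable_on UNIV"
    using assms by (simp add: wiener_series_def)
next
  fix z :: complex assume z: "z \<in> sphere 0 1"
  then have "((\<lambda>\<nu>. z powi \<nu> *\<^sub>m r \<nu>) has_sum \<rho> z) UNIV"
    using assms by (simp add: wiener_series_def)
  then have "((\<lambda>\<nu>. (z powi \<nu> *\<^sub>m r \<nu>)\<^sup>H) has_sum (\<rho> z)\<^sup>H) UNIV"
    by (rule has_sum_bounded_linear[OF linear_conj_transpose[unfolded linear_conv_bounded_linear]])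
  then show "((\<lambda>\<nu>. z powi \<nu> *\<^sub>m (r (- \<nu>))\<^sup>H) has_sum (\<rho> z)\<^sup>H) UNIV"
    by (subst has_sum_reindex_bij_witness[of _ uminus uminus])
       (auto simp: conj_transpose_mscale cnj_powi_sphere[OF z])
qed

lemma wiener_series_eq_0:
  fixes r :: "int \<Rightarrow> complex^'n^'k"
  assumes "wiener_series r \<rho>" "\<And>z. z \<in> sphere 0 1 \<Longrightarrow> \<rho> z = 0"
  shows "r \<nu> = 0"
proof -
  have "r \<nu> $ i $ j = 0" for i j
  proof (rule fourier_coefficients_unique[of "\<lambda>\<nu>. r \<nu> $ i $ j"])
    show "(\<lambda>\<nu>. norm (r \<nu> $ i $ j)) summable_on UNIV"
    proof (rule Infinite_Sum.abs_summable_on_comparison_test')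
      show "(\<lambda>\<nu>. norm (r \<nu>)) summable_on UNIV"
        using assms(1) by (simp add: wiener_series_def)
      show "norm (r \<nu> $ i $ j) \<le> norm (r \<nu>)" for \<nu>
        using Finite_Cartesian_Product.norm_nth_le[of "r \<nu> $ i" j]
          Finite_Cartesian_Product.norm_nth_le[of "r \<nu>" i]
        by linarith
    qed
    fix z :: complex assume "z \<in> sphere 0 1"
    then have "((\<lambda>\<nu>. z powi \<nu> *\<^sub>m r \<nu>) has_sum 0) UNIV"
      using assms by (auto simp: wiener_series_def)
    then have "((\<lambda>\<nu>. (z powi \<nu> *\<^sub>m r \<nu>) $ i $ j) has_sum 0 $ i $ j) UNIV"
      by (rule has_sum_bounded_linear[rotated])
         (intro bounded_linear_compose[OF bounded_linear_vec_nth] bounded_linear_vec_nth)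
    then show "((\<lambda>\<nu>. z powi \<nu> * r \<nu> $ i $ j) has_sum 0) UNIV"
      by (simp add: mscale_def)
  qed
  then show ?thesis by (simp add: vec_eq_iff)
qed

lemma wiener_series_unique:
  assumes "wiener_series r \<rho>" "wiener_series s \<sigma>" "\<And>z. z \<in> sphere 0 1 \<Longrightarrow> \<rho> z = \<sigma> z"
  shows "r = s"
  using wiener_series_eq_0[OF wiener_series_diff[OF assms(1,2)]] assms(3) by (simp add: fun_eq_iff)

lemma wiener_series_finite_support:
  assumes "wiener_series r \<rho>" "finite F" "\<And>\<nu>. \<nu> \<notin> F \<Longrightarrow> r \<nu> = 0" "z \<in> sphere 0 1"
  shows "\<rho> z = (\<Sum>\<nu>\<in>F. z powi \<nu> *\<^sub>m r \<nu>)"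
proof -
  have "((\<lambda>\<nu>. z powi \<nu> *\<^sub>m r \<nu>) has_sum \<rho> z) UNIV"
    using assms by (simp add: wiener_series_def)
  moreover have "((\<lambda>\<nu>. z powi \<nu> *\<^sub>m r \<nu>) has_sum (\<Sum>\<nu>\<in>F. z powi \<nu> *\<^sub>m r \<nu>)) UNIV"
    by (rule has_sum_finite_neutralI[of F]) (use assms in auto)
  ultimately show ?thesis by (rule has_sum_unique)
qed

section \<open>Wiener functions with prescribed spectrum\<close>

text \<open>With the set of admissible modes as a parameter, membership becomes arithmetic of index
  sets: sumsets for products, reflection for adjoints, intersection for two memberships of the same
  function.\<close>

definition wiener_on :: "int set \<Rightarrow> (complex \<Rightarrow> complex^'n^'k) set"
  where "wiener_on S = {\<rho>. \<exists>r. wiener_series r \<rho> \<and> (\<forall>\<nu>. \<nu> \<notin> S \<longrightarrow> r \<nu> = 0)}"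

lemma wiener_plus_eq: "wiener_plus = wiener_on {0..}"
  by (simp add: wiener_plus_def wiener_on_def not_le)

lemma wiener_plus_0_eq: "wiener_plus_0 = wiener_on {1..}"
proof -
  have "\<nu> \<notin> {1..} \<longleftrightarrow> \<nu> \<le> 0" for \<nu> :: int by auto
  then show ?thesis by (simp only: wiener_plus_0_def wiener_on_def)
qed

lemma wiener_minus_0_eq: "wiener_minus_0 = wiener_on {..-1}"
proof -
  have "\<nu> \<notin> {..-1} \<longleftrightarrow> \<nu> \<ge> 0" for \<nu> :: int by auto
  then show ?thesis by (simp only: wiener_minus_0_def wiener_on_def)
qed

lemma wiener_onI: "wiener_series r \<rho> \<Longrightarrow> (\<And>\<nu>. \<nu> \<notin> S \<Longrightarrow> r \<nu> = 0) \<Longrightarrow> \<rho> \<in> wiener_on S"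
  by (auto simp: wiener_on_def)

lemma wiener_onE:
  assumes "\<rho> \<in> wiener_on S"
  obtains r where "wiener_series r \<rho>" "\<And>\<nu>. \<nu> \<notin> S \<Longrightarrow> r \<nu> = 0"
  using assms by (auto simp: wiener_on_def)

lemma wiener_on_cong:
  assumes "\<sigma> \<in> wiener_on S" "\<And>z. z \<in> sphere 0 1 \<Longrightarrow> \<rho> z = \<sigma> z"
  shows "\<rho> \<in> wiener_on S"
  using assms wiener_series_cong[of \<rho> \<sigma>] by (auto simp: wiener_on_def)

lemma wiener_on_mono: "\<rho> \<in> wiener_on S \<Longrightarrow> S \<subseteq> T \<Longrightarrow> \<rho> \<in> wiener_on T"
  by (auto simp: wiener_on_def)

lemma wiener_on_add:
  "\<rho> \<in> wiener_on S \<Longrightarrow> \<sigma> \<in> wiener_on S \<Longrightarrow> (\<lambda>z. \<rho> z + \<sigma> z) \<in> wiener_on S"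
  by (elim wiener_onE, rule wiener_onI, erule (1) wiener_series_add) simp

lemma wiener_on_diff:
  "\<rho> \<in> wiener_on S \<Longrightarrow> \<sigma> \<in> wiener_on S \<Longrightarrow> (\<lambda>z. \<rho> z - \<sigma> z) \<in> wiener_on S"
  by (elim wiener_onE, rule wiener_onI, erule (1) wiener_series_diff) simp

lemma wiener_on_conj_transpose:
  "\<rho> \<in> wiener_on S \<Longrightarrow> (\<lambda>z. (\<rho> z)\<^sup>H) \<in> wiener_on (uminus ` S)"
  by (elim wiener_onE, rule wiener_onI, rule wiener_series_conj_transpose, assumption)
     (metis add.inverse_inverse conj_transpose_zero imageI)

lemma wiener_on_const: "0 \<in> S \<Longrightarrow> (\<lambda>_. A) \<in> wiener_on S"
  by (rule wiener_onI, rule wiener_series_const) auto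

lemma wiener_on_laurent_polynomial:
  "k ` I \<subseteq> S \<Longrightarrow> (\<lambda>z. \<Sum>i\<in>I. z powi k i *\<^sub>m A i) \<in> wiener_on S"
  by (rule wiener_onI, rule wiener_series_laurent_polynomial) (auto intro!: sum.neutral)

lemma wiener_on_mult_left:
  assumes "\<rho> \<in> wiener_on F" "finite F" "\<sigma> \<in> wiener_on S"
    and "\<And>f s. f \<in> F \<Longrightarrow> s \<in> S \<Longrightarrow> f + s \<in> T"
  shows "(\<lambda>z. \<rho> z ** \<sigma> z) \<in> wiener_on T"
proof -
  obtain r where r: "wiener_series r \<rho>" "\<And>\<nu>. \<nu> \<notin> F \<Longrightarrow> r \<nu> = 0"
    by (rule wiener_onE[OF assms(1)]) blast
  obtain s where s: "wiener_series s \<sigma>" "\<And>\<nu>. \<nu> \<notin> S \<Longrightarrow> s \<nu> = 0"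
    by (rule wiener_onE[OF assms(3)]) blast
  have "(\<lambda>z. (\<Sum>i\<in>F. z powi i *\<^sub>m r i) ** \<sigma> z) \<in> wiener_on T"
  proof (rule wiener_onI, rule wiener_series_mult_left[OF s(1)])
    fix \<nu> assume "\<nu> \<notin> T"
    then have "\<nu> - i \<notin> S" if "i \<in> F" for i
      using assms(4)[OF that, of "\<nu> - i"] by auto
    then show "(\<Sum>i\<in>F. r i ** s (\<nu> - i)) = 0" by (auto intro!: sum.neutral simp: s(2))
  qed
  then show ?thesis
    by (rule wiener_on_cong) (simp add: wiener_series_finite_support[OF r(1) assms(2) r(2)])
qed

text \<open>Taking adjoints exchanges the factors and reflects all spectra, which reduces this to
  \<open>wiener_on_mult_left\<close>.\<close>

lemma wiener_on_mult_right:
  assumes "\<rho> \<in> wiener_on F" "finite F" "\<sigma> \<in> wiener_on S"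
    and "\<And>f s. f \<in> F \<Longrightarrow> s \<in> S \<Longrightarrow> f + s \<in> T"
  shows "(\<lambda>z. \<sigma> z ** \<rho> z) \<in> wiener_on T"
proof -
  have "(\<lambda>z. (\<rho> z)\<^sup>H ** (\<sigma> z)\<^sup>H) \<in> wiener_on (uminus ` T)"
    by (rule wiener_on_mult_left[OF wiener_on_conj_transpose[OF assms(1)] _
          wiener_on_conj_transpose[OF assms(3)]])
       (use assms(2,4) in \<open>auto simp: image_iff intro!: bexI[of _ "_ + _"]\<close>)
  from wiener_on_conj_transpose[OF this] show ?thesis
    by (simp add: conj_transpose_mult image_image)
qed

lemma wiener_on_disjoint:
  assumes "\<rho> \<in> wiener_on S" "\<rho> \<in> wiener_on T" "S \<inter> T = {}" "z \<in> sphere 0 1"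
  shows "\<rho> z = 0"
proof -
  obtain r where r: "wiener_series r \<rho>" "\<And>\<nu>. \<nu> \<notin> S \<Longrightarrow> r \<nu> = 0"
    by (rule wiener_onE[OF assms(1)]) blast
  obtain s where s: "wiener_series s \<rho>" "\<And>\<nu>. \<nu> \<notin> T \<Longrightarrow> s \<nu> = 0"
    by (rule wiener_onE[OF assms(2)]) blast
  have "r = s" by (rule wiener_series_unique[OF r(1) s(1)]) simp
  with r(2) s(2) assms(3) have "r \<nu> = 0" for \<nu> by (metis disjoint_iff)
  then show ?thesis using wiener_series_finite_support[OF r(1), of "{}"] assms(4) by simp
qed

lemma wiener_on_Int:
  assumes "\<rho> \<in> wiener_on S" "\<rho> \<in> wiener_on T" shows "\<rho> \<in> wiener_on (S \<inter> T)"
proof -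
  obtain r where r: "wiener_series r \<rho>" "\<And>\<nu>. \<nu> \<notin> S \<Longrightarrow> r \<nu> = 0"
    by (rule wiener_onE[OF assms(1)]) blast
  obtain s where s: "wiener_series s \<rho>" "\<And>\<nu>. \<nu> \<notin> T \<Longrightarrow> s \<nu> = 0"
    by (rule wiener_onE[OF assms(2)]) blast
  have "r = s" by (rule wiener_series_unique[OF r(1) s(1)]) simp
  with r s show ?thesis by (auto intro: wiener_onI)
qed

lemma wiener_on_coefficients:
  assumes "wiener_series r \<rho>" "\<rho> \<in> wiener_on S" "\<nu> \<notin> S"
  shows "r \<nu> = 0"
  using assms wiener_series_unique[OF assms(1)] by (metis wiener_onE)

text \<open>The condition on \<open>S\<close> says that it is disjoint from its reflection and omits
  0. Adjoints move the spectrum of \<rho> - A to the reflection, with A replaced by its adjoint. The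
  difference of the two is a constant without zero mode, so A is Hermitian; then \<rho> - A itself
  has two disjoint spectra and vanishes.\<close>

lemma hermitian_eq_constant:
  fixes A :: "complex^'n^'n"
  assumes "(\<lambda>z. \<rho> z - A) \<in> wiener_on S" "\<And>s t. s \<in> S \<Longrightarrow> t \<in> S \<Longrightarrow> s + t \<noteq> 0"
    and herm: "\<And>z. z \<in> sphere 0 1 \<Longrightarrow> (\<rho> z)\<^sup>H = \<rho> z"
    and z: "z \<in> sphere 0 1"
  shows "\<rho> z = A" "A\<^sup>H = A"
proof -
  have neg: "(\<lambda>z. \<rho> z - A\<^sup>H) \<in> wiener_on (uminus ` S)"
    by (rule wiener_on_cong[OF wiener_on_conj_transpose[OF assms(1)]])
       (simp add: conj_transpose_diff herm)
  have "(\<lambda>z. (\<rho> z - A) - (\<rho> z - A\<^sup>H)) \<in> wiener_on (S \<union> uminus ` S)"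
    by (intro wiener_on_diff wiener_on_mono[OF assms(1)] wiener_on_mono[OF neg]) auto
  then have "(\<lambda>z. A\<^sup>H - A) \<in> wiener_on (S \<union> uminus ` S)" by simp
  moreover have "(\<lambda>z. A\<^sup>H - A) \<in> wiener_on {0}" by (simp add: wiener_on_const)
  ultimately have "A\<^sup>H - A = 0"
    by (rule wiener_on_disjoint[OF _ _ _ z]) (use assms(2) in force)
  then show "A\<^sup>H = A" by simp
  have "\<rho> z - A = 0"
    by (rule wiener_on_disjoint[OF assms(1) neg[unfolded \<open>A\<^sup>H = A\<close>] _ z]) (use assms(2) in force)
  then show "\<rho> z = A" by simp
qed

section \<open>The twofold EG inverse problem for polynomial data\<close>

locale twofold_EG_data =
  fixes m :: nat
    and a :: "nat \<Rightarrow> complex^'p^'p" and b :: "nat \<Rightarrow> complex^'q^'p"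
    and c :: "int \<Rightarrow> complex^'p^'q" and d :: "int \<Rightarrow> complex^'q^'q"
    and \<alpha> :: "complex \<Rightarrow> complex^'p^'p" and \<beta> :: "complex \<Rightarrow> complex^'q^'p"
    and \<gamma> :: "complex \<Rightarrow> complex^'p^'q" and \<delta> :: "complex \<Rightarrow> complex^'q^'q"
  assumes \<alpha>: "\<alpha> = (\<lambda>z. \<Sum>j\<le>m. z ^ j *\<^sub>m a j)"
    and \<beta>: "\<beta> = (\<lambda>z. \<Sum>j\<le>m. z ^ j *\<^sub>m b j)"
    and \<gamma>: "\<gamma> = (\<lambda>z. \<Sum>j\<le>m. z powi (- int j) *\<^sub>m c (- int j))"
    and \<delta>: "\<delta> = (\<lambda>z. \<Sum>j\<le>m. z powi (- int j) *\<^sub>m d (- int j))"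
    and a0: "invertible (a 0)"
    and d0: "invertible (d 0)"
begin

section \<open>Spectra and Fourier coefficients of the data\<close>

lemma \<alpha>_powi: "\<alpha> = (\<lambda>z. \<Sum>j\<le>m. z powi int j *\<^sub>m a j)"
  and \<beta>_powi: "\<beta> = (\<lambda>z. \<Sum>j\<le>m. z powi int j *\<^sub>m b j)"
  by (simp_all add: \<alpha> \<beta>)

lemma \<alpha>_on: "\<alpha> \<in> wiener_on {0..int m}"
  unfolding \<alpha>_powi by (rule wiener_on_laurent_polynomial) auto

lemma \<beta>_on: "\<beta> \<in> wiener_on {0..int m}"
  unfolding \<beta>_powi by (rule wiener_on_laurent_polynomial) auto

lemma \<gamma>_on: "\<gamma> \<in> wiener_on {- int m..0}"
  unfolding \<gamma> by (rule wiener_on_laurent_polynomial) auto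

lemma \<delta>_on: "\<delta> \<in> wiener_on {- int m..0}"
  unfolding \<delta> by (rule wiener_on_laurent_polynomial) auto

lemma \<alpha>H_on: "(\<lambda>z. (\<alpha> z)\<^sup>H) \<in> wiener_on {- int m..0}"
  using wiener_on_conj_transpose[OF \<alpha>_on] by simp

lemma \<beta>H_on: "(\<lambda>z. (\<beta> z)\<^sup>H) \<in> wiener_on {- int m..0}"
  using wiener_on_conj_transpose[OF \<beta>_on] by simp

lemma \<gamma>H_on: "(\<lambda>z. (\<gamma> z)\<^sup>H) \<in> wiener_on {0..int m}"
  using wiener_on_conj_transpose[OF \<gamma>_on] by simp

lemma \<delta>H_on: "(\<lambda>z. (\<delta> z)\<^sup>H) \<in> wiener_on {0..int m}"
  using wiener_on_conj_transpose[OF \<delta>_on] by simp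

lemma \<alpha>_minus_a0_on: "(\<lambda>z. \<alpha> z - a 0) \<in> wiener_on {1..}"
proof (rule wiener_on_cong)
  show "(\<lambda>z. \<Sum>j<m. z powi int (Suc j) *\<^sub>m a (Suc j)) \<in> wiener_on {1..}"
    by (rule wiener_on_laurent_polynomial) auto
qed (simp add: \<alpha>_powi sum.atMost_shift del: of_nat_Suc)

lemma \<delta>_minus_d0_on: "(\<lambda>z. \<delta> z - d 0) \<in> wiener_on {..-1}"
proof (rule wiener_on_cong)
  show "(\<lambda>z. \<Sum>j<m. z powi (- int (Suc j)) *\<^sub>m d (- int (Suc j))) \<in> wiener_on {..-1}"
    by (rule wiener_on_laurent_polynomial) auto
qed (simp add: \<delta> sum.atMost_shift del: of_nat_Suc)

lemma \<alpha>H_sum: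
  "z \<in> sphere 0 1 \<Longrightarrow> (\<alpha> z)\<^sup>H = (\<Sum>j\<le>m. z powi (- int j) *\<^sub>m (a j)\<^sup>H)"
  unfolding \<alpha>_powi conj_transpose_sum conj_transpose_mscale complex_cnj_power_int
  by (simp only: cnj_powi_sphere)

lemma \<gamma>H_sum:
  "z \<in> sphere 0 1 \<Longrightarrow> (\<gamma> z)\<^sup>H = (\<Sum>j\<le>m. z powi int j *\<^sub>m (c (- int j))\<^sup>H)"
  unfolding \<gamma> conj_transpose_sum conj_transpose_mscale complex_cnj_power_int
  by (simp only: cnj_powi_sphere minus_minus)

lemma wiener_series_\<alpha>H_mult:
  assumes "wiener_series r \<rho>"
  shows "wiener_series (\<lambda>\<nu>. \<Sum>j\<le>m. (a j)\<^sup>H ** r (\<nu> + int j)) (\<lambda>z. (\<alpha> z)\<^sup>H ** \<rho> z)"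
  using wiener_series_cong[THEN iffD1, OF _ wiener_series_mult_left[OF assms,
    where A = "\<lambda>j. (a j)\<^sup>H" and k = "\<lambda>j. - int j" and I = "{..m}"]]
  by (simp add: \<alpha>H_sum)

lemma wiener_series_mult_\<delta>:
  assumes "wiener_series r \<rho>"
  shows "wiener_series (\<lambda>\<nu>. \<Sum>j\<le>m. r (\<nu> + int j) ** d (- int j)) (\<lambda>z. \<rho> z ** \<delta> z)"
  using wiener_series_mult_right[OF assms, where A = "\<lambda>j. d (- int j)" and k = "\<lambda>j. - int j" and I = "{..m}"]
  by (simp add: \<delta>)

text \<open>The constant term of \<open>\<alpha>\<^sup>H\<close> is \<open>(a 0)\<^sup>H\<close> and
  all its other modes are negative, so the highest mode of \<rho> survives in the product. The bound
  N guarantees that there is a highest mode from which to start.\<close>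

lemma \<alpha>H_cancel:
  assumes "\<rho> \<in> wiener_on {..N}" "(\<lambda>z. (\<alpha> z)\<^sup>H ** \<rho> z) \<in> wiener_on {..-1}"
  shows "\<rho> \<in> wiener_on {..-1}"
proof -
  obtain r where r: "wiener_series r \<rho>" "\<And>\<nu>. \<nu> \<notin> {..N} \<Longrightarrow> r \<nu> = 0"
    by (rule wiener_onE[OF assms(1)]) blast
  have eq: "(\<Sum>j\<le>m. (a j)\<^sup>H ** r (\<nu> + int j)) = 0" if "\<nu> \<ge> 0" for \<nu>
    using wiener_on_coefficients[OF wiener_series_\<alpha>H_mult[OF r(1)] assms(2)] that by simp
  have "r \<nu> = 0" if "\<nu> \<ge> 0" for \<nu>
    by (rule back_substitution[where L = "\<lambda>j A. (a j)\<^sup>H ** A" and m = m and N = N])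
       (use that r(2) eq invertible_mult_left_eq_0[OF invertible_conj_transpose[OF a0]] in auto)
  then show ?thesis by (intro wiener_onI[OF r(1)]) simp
qed

lemma \<delta>_cancel:
  assumes "\<rho> \<in> wiener_on {..N}" "(\<lambda>z. \<rho> z ** \<delta> z) \<in> wiener_on {..-1}"
  shows "\<rho> \<in> wiener_on {..-1}"
proof -
  obtain r where r: "wiener_series r \<rho>" "\<And>\<nu>. \<nu> \<notin> {..N} \<Longrightarrow> r \<nu> = 0"
    by (rule wiener_onE[OF assms(1)]) blast
  have eq: "(\<Sum>j\<le>m. r (\<nu> + int j) ** d (- int j)) = 0" if "\<nu> \<ge> 0" for \<nu>
    using wiener_on_coefficients[OF wiener_series_mult_\<delta>[OF r(1)] assms(2)] that by simp
  have "r \<nu> = 0" if "\<nu> \<ge> 0" for \<nu>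
    by (rule back_substitution[where L = "\<lambda>j A. A ** d (- int j)" and m = m and N = N])
       (use that r(2) eq invertible_mult_right_eq_0[OF d0] in auto)
  then show ?thesis by (intro wiener_onI[OF r(1)]) simp
qed

text \<open>The rows of the triangular system are the coefficients of the second function at the
  modes 0 to m; at higher modes both summands have no coefficients.\<close>

lemma toeplitz_a_adj_iff:
  assumes r: "wiener_series r g" "\<forall>\<nu>>int m. r \<nu> = 0"
  shows "(\<lambda>z. (\<alpha> z)\<^sup>H ** g z + (\<gamma> z)\<^sup>H) \<in> wiener_on {..-1} \<longleftrightarrow>
    (\<forall>i\<le>m. block_apply m (toeplitz_a_adj a) (\<lambda>k. r (int k)) i = - (c (- int i))\<^sup>H)"
proof -
  let ?s = "\<lambda>\<nu>. (\<Sum>j\<le>m. (a j)\<^sup>H ** r (\<nu> + int j)) + (\<Sum>j\<le>m. if \<nu> = int j then (c (- int j))\<^sup>H else 0)"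
  have s: "wiener_series ?s (\<lambda>z. (\<alpha> z)\<^sup>H ** g z + (\<gamma> z)\<^sup>H)"
    by (rule wiener_series_cong[THEN iffD1, OF _ wiener_series_add[OF wiener_series_\<alpha>H_mult[OF r(1)]
        wiener_series_laurent_polynomial[where k = int]]])
       (simp only: \<gamma>H_sum)
  have small: "?s (int i) = block_apply m (toeplitz_a_adj a) (\<lambda>k. r (int k)) i + (c (- int i))\<^sup>H"
    if "i \<le> m" for i
  proof -
    \<comment> \<open>Dropping the coefficients of \<open>g\<close> beyond m is what cuts the
      convolution down to the upper triangle.\<close>
    have tail: "r (int i + int j) = 0" if "m - i < j" for j
      using that by (intro r(2)[rule_format]) linarith
    have "(\<Sum>j\<le>m. (a j)\<^sup>H ** r (int i + int j)) = (\<Sum>j\<in>{..m - i}. (a j)\<^sup>H ** r (int i + int j))"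
      by (rule sum.mono_neutral_right) (simp_all add: tail)
    also have "\<dots> = (\<Sum>l\<in>{i..m}. (a (l - i))\<^sup>H ** r (int l))"
      using that by (intro sum.reindex_bij_witness[of _ "\<lambda>l. l - i" "\<lambda>j. i + j"]) auto
    also have "\<dots> = block_apply m (toeplitz_a_adj a) (\<lambda>k. r (int k)) i"
      unfolding block_apply_def by (rule sum.mono_neutral_cong_left) (auto simp: toeplitz_a_adj_def)
    finally show ?thesis using that by simp
  qed
  have large: "?s \<nu> = 0" if "\<nu> > int m" for \<nu>
    using that r(2) by (auto intro: sum.neutral)
  show ?thesis
  proof
    assume *: "(\<lambda>z. (\<alpha> z)\<^sup>H ** g z + (\<gamma> z)\<^sup>H) \<in> wiener_on {..-1}"
    have s0: "?s (int i) = 0" for i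
      by (rule wiener_on_coefficients[where \<nu> = "int i", OF s *]) simp
    have "block_apply m (toeplitz_a_adj a) (\<lambda>k. r (int k)) i + (c (- int i))\<^sup>H = 0" if "i \<le> m" for i
      unfolding small[OF that, symmetric] by (rule s0)
    then show "\<forall>i\<le>m. block_apply m (toeplitz_a_adj a) (\<lambda>k. r (int k)) i = - (c (- int i))\<^sup>H"
      by (simp add: add_eq_0_iff2)
  next
    assume *: "\<forall>i\<le>m. block_apply m (toeplitz_a_adj a) (\<lambda>k. r (int k)) i = - (c (- int i))\<^sup>H"
    have "?s \<nu> = 0" if "\<nu> \<notin> {..-1}" for \<nu>
    proof (cases "\<nu> > int m")
      case True then show ?thesis by (rule large)
    next
      case False
      then have "nat \<nu> \<le> m" "int (nat \<nu>) = \<nu>" using that by auto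
      with small[of "nat \<nu>"] * show ?thesis by simp
    qed
    with s show "(\<lambda>z. (\<alpha> z)\<^sup>H ** g z + (\<gamma> z)\<^sup>H) \<in> wiener_on {..-1}"
      by (rule wiener_onI)
  qed
qed

text \<open>The coefficients of the fourth function at the modes 0 to m. Here \<delta> multiplies
  from the right, so the blocks of \<open>toeplitz_d\<close> stand behind the unknowns and this is
  no instance of \<open>block_apply\<close>.\<close>

lemma toeplitz_d_row:
  assumes r: "wiener_series r g" "\<forall>\<nu>>int m. r \<nu> = 0"
    and g: "(\<lambda>z. g z ** \<delta> z + \<beta> z) \<in> wiener_on {..-1}" and "i \<le> m"
  shows "(\<Sum>k\<le>m. r (int k) ** toeplitz_d d i k) = - b i"
proof -
  have tail: "r (int i + int j) = 0" if "m - i < j" for j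
    using that by (intro r(2)[rule_format]) linarith
  have "(\<Sum>j\<le>m. r (int i + int j) ** d (- int j)) + (\<Sum>j\<le>m. if int i = int j then b j else 0) = 0"
    using wiener_on_coefficients[OF wiener_series_add[OF wiener_series_mult_\<delta>[OF r(1)]
      wiener_series_laurent_polynomial[of int b "{..m}"]] g[unfolded \<beta>_powi], of "int i"] by simp
  then have "(\<Sum>j\<le>m. r (int i + int j) ** d (- int j)) = - b i"
    using \<open>i \<le> m\<close> by (simp add: add_eq_0_iff2)
  moreover have "(\<Sum>j\<le>m. r (int i + int j) ** d (- int j)) = (\<Sum>j\<in>{..m - i}. r (int i + int j) ** d (- int j))"
    by (rule sum.mono_neutral_right) (simp_all add: tail)
  moreover have "\<dots> = (\<Sum>k\<in>{i..m}. r (int k) ** d (int i - int k))"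
    using \<open>i \<le> m\<close> by (intro sum.reindex_bij_witness[of _ "\<lambda>k. k - i" "\<lambda>j. i + j"]) auto
  moreover have "\<dots> = (\<Sum>k\<le>m. r (int k) ** toeplitz_d d i k)"
    by (rule sum.mono_neutral_cong_left) (auto simp: toeplitz_d_def)
  ultimately show ?thesis by simp
qed

lemma block_invertible_toeplitz_d: "block_invertible m (toeplitz_d d)"
  unfolding toeplitz_d_eq by (rule block_invertible_upper_toeplitz) (simp add: d0)

lemma block_invertible_toeplitz_a_adj: "block_invertible m (toeplitz_a_adj a)"
  unfolding toeplitz_a_adj_eq
  by (rule block_invertible_upper_toeplitz) (simp add: a0 invertible_conj_transpose)

text \<open>Inserting the equations for the blocks of b turns each entry of the product into a sum
  over the unknowns x k. The Toeplitz symmetry lets the matrix of d act on \<open>e\<close> there,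
  and \<open>e\<close> was chosen so that this action leaves a single unit block, which selects x
  i.\<close>

lemma toeplitz_b_formula:
  assumes r: "\<And>i. i \<le> m \<Longrightarrow> (\<Sum>k\<le>m. x k ** toeplitz_d d i k) = - b i"
    and e: "\<And>i. i \<le> m \<Longrightarrow> block_apply m (toeplitz_d d) e i = (if i = m then mat 1 else 0)"
    and "i \<le> m"
  shows "block_apply m (toeplitz_b m b) e i = - x i"
proof -
  have "toeplitz_b m b i l ** e l = - (\<Sum>k\<in>{i..m}. x k ** (toeplitz_d d (m + i - k) l ** e l))"
    if "l \<le> m" for l
  proof (cases "i \<le> l")
    case True
    \<comment> \<open>The block at (m + i - k, l) depends only on m + i - k - l and so equals the
      block at (m + i - l, k). For k < i the latter lies below the diagonal.\<close>
    have "(\<Sum>k\<in>{i..m}. x k ** toeplitz_d d (m + i - k) l) = (\<Sum>k\<le>m. x k ** toeplitz_d d (m + i - l) k)"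
      by (rule sum.mono_neutral_cong_left)
         (use True that in \<open>auto simp: toeplitz_d_def of_nat_diff algebra_simps\<close>)
    also have "(\<Sum>k\<le>m. x k ** toeplitz_d d (m + i - l) k) = - b (m + i - l)"
      by (rule r) (use True in simp)
    finally have "b (m + i - l) = - (\<Sum>k\<in>{i..m}. x k ** toeplitz_d d (m + i - k) l)"
      by (metis add.inverse_inverse)
    with True show ?thesis
      by (simp add: toeplitz_b_def matrix_mult_minus_left matrix_mult_sum_left matrix_mul_assoc)
  next
    case False
    then show ?thesis
      by (auto simp: toeplitz_b_def toeplitz_d_def intro!: sum.neutral)
  qed
  then have "block_apply m (toeplitz_b m b) e i =
      - (\<Sum>l\<le>m. \<Sum>k\<in>{i..m}. x k ** (toeplitz_d d (m + i - k) l ** e l))"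
    by (simp add: block_apply_def sum_negf)
  also have "(\<Sum>l\<le>m. \<Sum>k\<in>{i..m}. x k ** (toeplitz_d d (m + i - k) l ** e l)) =
      (\<Sum>k\<in>{i..m}. x k ** block_apply m (toeplitz_d d) e (m + i - k))"
    by (subst sum.swap) (simp add: block_apply_def matrix_mult_sum_right)
  \<comment> \<open>The row m + i - k is the last one exactly when k = i.\<close>
  also have "\<dots> = (\<Sum>k\<in>{i..m}. if k = i then x k else 0)"
    by (intro sum.cong) (auto simp: e)
  also have "\<dots> = x i" using \<open>i \<le> m\<close> by simp
  finally show ?thesis .
qed

section \<open>Solutions, the identities and the coefficient formulas\<close>

lemma solution_iff:
  "twofold_EG_solution \<alpha> \<beta> \<gamma> \<delta> g \<longleftrightarrow>
    g \<in> wiener_on {0..} \<and>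
    (\<lambda>z. \<alpha> z + g z ** \<gamma> z - mat 1) \<in> wiener_on {..-1} \<and>
    (\<lambda>z. (\<alpha> z)\<^sup>H ** g z + (\<gamma> z)\<^sup>H) \<in> wiener_on {..-1} \<and>
    (\<lambda>z. (\<delta> z)\<^sup>H + (\<beta> z)\<^sup>H ** g z - mat 1) \<in> wiener_on {..-1} \<and>
    (\<lambda>z. g z ** \<delta> z + \<beta> z) \<in> wiener_on {..-1}"
proof -
  have adj: "(\<lambda>z. (\<rho> z)\<^sup>H) \<in> wiener_on {1..} \<longleftrightarrow> \<rho> \<in> wiener_on {..-1}"
    for \<rho> :: "complex \<Rightarrow> complex^'n^'k"
    using wiener_on_conj_transpose[of \<rho> "{..-1}"] wiener_on_conj_transpose[of "\<lambda>z. (\<rho> z)\<^sup>H" "{1..}"]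
    by auto
  show ?thesis
    unfolding twofold_EG_solution_def wiener_plus_eq wiener_plus_0_eq wiener_minus_0_eq
    using adj[of "\<lambda>z. (\<alpha> z)\<^sup>H ** g z + (\<gamma> z)\<^sup>H"] adj[of "\<lambda>z. (\<delta> z)\<^sup>H + (\<beta> z)\<^sup>H ** g z - mat 1"]
    by (simp add: conj_transpose_algebra)
qed

lemma solution_imp_identities:
  assumes sol: "twofold_EG_solution \<alpha> \<beta> \<gamma> \<delta> g" and z: "z \<in> sphere 0 1"
  shows "(\<alpha> z)\<^sup>H ** \<alpha> z - (\<gamma> z)\<^sup>H ** \<gamma> z = a 0"
    and "(\<delta> z)\<^sup>H ** \<delta> z - (\<beta> z)\<^sup>H ** \<beta> z = d 0"
    and "(\<alpha> z)\<^sup>H ** \<beta> z = (\<gamma> z)\<^sup>H ** \<delta> z"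
proof -
  let ?X1 = "\<lambda>z. \<alpha> z + g z ** \<gamma> z - mat 1" and ?X2 = "\<lambda>z. (\<alpha> z)\<^sup>H ** g z + (\<gamma> z)\<^sup>H"
    and ?X3 = "\<lambda>z. (\<delta> z)\<^sup>H + (\<beta> z)\<^sup>H ** g z - mat 1" and ?X4 = "\<lambda>z. g z ** \<delta> z + \<beta> z"
  have X: "?X1 \<in> wiener_on {..-1}" "?X2 \<in> wiener_on {..-1}" "?X3 \<in> wiener_on {..-1}"
    "?X4 \<in> wiener_on {..-1}"
    using sol by (simp_all add: solution_iff)
  note XH = wiener_on_conj_transpose[OF X(1), simplified]
    wiener_on_conj_transpose[OF X(3), simplified] wiener_on_conj_transpose[OF X(4), simplified]
  \<comment> \<open>The middle term restores the adjoint of \<alpha> lost to the -I in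
    \<open>?X1\<close>, except for its constant \<open>(a 0)\<^sup>H\<close>, which becomes the
    candidate value of the identity. That \<open>a 0\<close> is Hermitian is a consequence.\<close>
  have "(\<lambda>z. (\<alpha> z)\<^sup>H ** ?X1 z + (\<alpha> z - a 0)\<^sup>H - ?X2 z ** \<gamma> z) \<in> wiener_on {..-1}"
  proof (intro wiener_on_add wiener_on_diff)
    show "(\<lambda>z. (\<alpha> z)\<^sup>H ** ?X1 z) \<in> wiener_on {..-1}"
      by (rule wiener_on_mult_left[OF \<alpha>H_on _ X(1)]) auto
    show "(\<lambda>z. ?X2 z ** \<gamma> z) \<in> wiener_on {..-1}"
      by (rule wiener_on_mult_right[OF \<gamma>_on _ X(2)]) auto
    show "(\<lambda>z. (\<alpha> z - a 0)\<^sup>H) \<in> wiener_on {..-1}"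
      using wiener_on_conj_transpose[OF \<alpha>_minus_a0_on] by simp
  qed
  then have *: "(\<lambda>z. (\<alpha> z)\<^sup>H ** \<alpha> z - (\<gamma> z)\<^sup>H ** \<gamma> z - (a 0)\<^sup>H) \<in> wiener_on {..-1}"
    by (rule wiener_on_cong) (simp add: conj_transpose_algebra matrix_algebra matrix_mul_assoc)
  have "((a 0)\<^sup>H)\<^sup>H = (a 0)\<^sup>H"
    by (rule hermitian_eq_constant(2)[OF * _ _ z]) (auto simp: conj_transpose_algebra)
  moreover have "(\<alpha> z)\<^sup>H ** \<alpha> z - (\<gamma> z)\<^sup>H ** \<gamma> z = (a 0)\<^sup>H"
    by (rule hermitian_eq_constant(1)[OF * _ _ z]) (auto simp: conj_transpose_algebra)
  ultimately show "(\<alpha> z)\<^sup>H ** \<alpha> z - (\<gamma> z)\<^sup>H ** \<gamma> z = a 0" by simp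

  \<comment> \<open>The mirror image: with the adjoints of the third and fourth functions every term
    has only positive modes.\<close>
  have "(\<lambda>z. (\<delta> z)\<^sup>H ** (?X3 z)\<^sup>H + (\<delta> z - d 0)\<^sup>H - (?X4 z)\<^sup>H ** \<beta> z) \<in> wiener_on {1..}"
  proof (intro wiener_on_add wiener_on_diff)
    show "(\<lambda>z. (\<delta> z)\<^sup>H ** (?X3 z)\<^sup>H) \<in> wiener_on {1..}"
      by (rule wiener_on_mult_left[OF \<delta>H_on _ XH(2)]) auto
    show "(\<lambda>z. (?X4 z)\<^sup>H ** \<beta> z) \<in> wiener_on {1..}"
      by (rule wiener_on_mult_right[OF \<beta>_on _ XH(3)]) auto
    show "(\<lambda>z. (\<delta> z - d 0)\<^sup>H) \<in> wiener_on {1..}"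
      using wiener_on_conj_transpose[OF \<delta>_minus_d0_on] by simp
  qed
  then have *: "(\<lambda>z. (\<delta> z)\<^sup>H ** \<delta> z - (\<beta> z)\<^sup>H ** \<beta> z - (d 0)\<^sup>H) \<in> wiener_on {1..}"
    by (rule wiener_on_cong) (simp add: conj_transpose_algebra matrix_algebra matrix_mul_assoc)
  have "((d 0)\<^sup>H)\<^sup>H = (d 0)\<^sup>H"
    by (rule hermitian_eq_constant(2)[OF * _ _ z]) (auto simp: conj_transpose_algebra)
  moreover have "(\<delta> z)\<^sup>H ** \<delta> z - (\<beta> z)\<^sup>H ** \<beta> z = (d 0)\<^sup>H"
    by (rule hermitian_eq_constant(1)[OF * _ _ z]) (auto simp: conj_transpose_algebra)
  ultimately show "(\<delta> z)\<^sup>H ** \<delta> z - (\<beta> z)\<^sup>H ** \<beta> z = d 0" by simp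

  have "(\<lambda>z. (\<alpha> z)\<^sup>H ** ?X4 z - ?X2 z ** \<delta> z) \<in> wiener_on {..-1}"
  proof (intro wiener_on_diff)
    show "(\<lambda>z. (\<alpha> z)\<^sup>H ** ?X4 z) \<in> wiener_on {..-1}"
      by (rule wiener_on_mult_left[OF \<alpha>H_on _ X(4)]) auto
    show "(\<lambda>z. ?X2 z ** \<delta> z) \<in> wiener_on {..-1}"
      by (rule wiener_on_mult_right[OF \<delta>_on _ X(2)]) auto
  qed
  then have neg: "(\<lambda>z. (\<alpha> z)\<^sup>H ** \<beta> z - (\<gamma> z)\<^sup>H ** \<delta> z) \<in> wiener_on {..-1}"
    by (rule wiener_on_cong) (simp add: matrix_algebra matrix_mul_assoc)
  \<comment> \<open>There is no Hermitian symmetry for the mixed identity, so the same difference is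
    computed a second time, from the first and third conditions, and comes out with nonnegative
    modes.\<close>
  have "(\<lambda>z. (?X1 z)\<^sup>H ** \<beta> z + \<beta> z - ((\<gamma> z)\<^sup>H ** (?X3 z)\<^sup>H + (\<gamma> z)\<^sup>H)) \<in> wiener_on {0..}"
  proof (intro wiener_on_add wiener_on_diff)
    show "(\<lambda>z. (?X1 z)\<^sup>H ** \<beta> z) \<in> wiener_on {0..}"
      by (rule wiener_on_mult_right[OF \<beta>_on _ XH(1)]) auto
    show "(\<lambda>z. (\<gamma> z)\<^sup>H ** (?X3 z)\<^sup>H) \<in> wiener_on {0..}"
      by (rule wiener_on_mult_left[OF \<gamma>H_on _ XH(2)]) auto
    show "\<beta> \<in> wiener_on {0..}" "(\<lambda>z. (\<gamma> z)\<^sup>H) \<in> wiener_on {0..}"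
      using wiener_on_mono[OF \<beta>_on] wiener_on_mono[OF \<gamma>H_on] by auto
  qed
  then have pos: "(\<lambda>z. (\<alpha> z)\<^sup>H ** \<beta> z - (\<gamma> z)\<^sup>H ** \<delta> z) \<in> wiener_on {0..}"
    by (rule wiener_on_cong) (simp add: conj_transpose_algebra matrix_algebra matrix_mul_assoc)
  have "(\<alpha> z)\<^sup>H ** \<beta> z - (\<gamma> z)\<^sup>H ** \<delta> z = 0"
    by (rule wiener_on_disjoint[OF neg pos _ z]) auto
  then show "(\<alpha> z)\<^sup>H ** \<beta> z = (\<gamma> z)\<^sup>H ** \<delta> z" by simp
qed

lemma solution_degree:
  assumes sol: "twofold_EG_solution \<alpha> \<beta> \<gamma> \<delta> g"
  shows "g \<in> wiener_on {0..int m}"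
proof -
  let ?X2 = "\<lambda>z. (\<alpha> z)\<^sup>H ** g z + (\<gamma> z)\<^sup>H" and ?X3 = "\<lambda>z. (\<delta> z)\<^sup>H + (\<beta> z)\<^sup>H ** g z - mat 1"
  have g: "g \<in> wiener_on {0..}"
    and X: "?X2 \<in> wiener_on {..-1}" "?X3 \<in> wiener_on {..-1}"
    using sol by (simp_all add: solution_iff)
  obtain a' d' where a': "a' ** a 0 = mat 1" and d': "d' ** d 0 = mat 1"
    using a0 d0 by (auto simp: invertible_def)
  have "(\<lambda>z. \<alpha> z ** (a' ** ?X2 z) - \<beta> z ** (d' ** ?X3 z) - \<beta> z ** d') \<in> wiener_on {..int m}"
  proof (intro wiener_on_diff)
    have X2': "(\<lambda>z. a' ** ?X2 z) \<in> wiener_on {..-1}"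
      by (rule wiener_on_mult_left[OF wiener_on_const[of "{0}"] _ X(1)]) auto
    have X3': "(\<lambda>z. d' ** ?X3 z) \<in> wiener_on {..-1}"
      by (rule wiener_on_mult_left[OF wiener_on_const[of "{0}"] _ X(2)]) auto
    show "(\<lambda>z. \<alpha> z ** (a' ** ?X2 z)) \<in> wiener_on {..int m}"
      by (rule wiener_on_mult_left[OF \<alpha>_on _ X2']) auto
    show "(\<lambda>z. \<beta> z ** (d' ** ?X3 z)) \<in> wiener_on {..int m}"
      by (rule wiener_on_mult_left[OF \<beta>_on _ X3']) auto
    show "(\<lambda>z. \<beta> z ** d') \<in> wiener_on {..int m}"
      by (rule wiener_on_mult_left[OF \<beta>_on _ wiener_on_const[of "{0}"]]) auto
  qed
  then have "g \<in> wiener_on {..int m}"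
  proof (rule wiener_on_cong)
    fix z :: complex assume "z \<in> sphere 0 1"
    note dual = J_unitary_dual[OF solution_imp_identities[OF sol this] a' d']
    \<comment> \<open>By the dual relations the first bracket is the identity and the second is
      zero. The -I inside \<open>?X3\<close> produces the correction \<beta> d' in the next
      line.\<close>
    have "g z = (\<alpha> z ** a' ** (\<alpha> z)\<^sup>H - \<beta> z ** d' ** (\<beta> z)\<^sup>H) ** g z
        + (\<alpha> z ** a' ** (\<gamma> z)\<^sup>H - \<beta> z ** d' ** (\<delta> z)\<^sup>H)"
      by (simp add: dual)
    also have "\<dots> = \<alpha> z ** (a' ** ?X2 z) - \<beta> z ** (d' ** ?X3 z) - \<beta> z ** d'"
      by (simp add: matrix_algebra matrix_mul_assoc)
    finally show "g z = \<alpha> z ** (a' ** ?X2 z) - \<beta> z ** (d' ** ?X3 z) - \<beta> z ** d'" .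
  qed
  from wiener_on_Int[OF g this] show ?thesis by (rule wiener_on_mono) auto
qed

text \<open>The formula with b comes from the fourth condition and the formula with the adjoint of a
  from the second. Either one determines \<open>g\<close> on the circle.\<close>

lemma solution_coefficients:
  assumes sol: "twofold_EG_solution \<alpha> \<beta> \<gamma> \<delta> g"
    and e: "\<And>i. i \<le> m \<Longrightarrow> block_apply m (toeplitz_d d) e i = (if i = m then mat 1 else 0)"
  shows "\<exists>G. (\<forall>z\<in>sphere 0 1. g z = (\<Sum>k\<le>m. z ^ k *\<^sub>m G k)) \<and>
    (\<forall>i\<le>m. G i = - block_apply m (toeplitz_b m b) e i) \<and>
    (\<forall>i\<le>m. G i = - block_apply m (block_inv m (toeplitz_a_adj a)) (\<lambda>k. (c (- int k))\<^sup>H) i)"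
proof -
  obtain r where r: "wiener_series r g" "\<And>\<nu>. \<nu> \<notin> {0..int m} \<Longrightarrow> r \<nu> = 0"
    by (rule wiener_onE[OF solution_degree[OF sol]]) blast
  then have r_large: "\<forall>\<nu>>int m. r \<nu> = 0" by simp
  have X2: "(\<lambda>z. (\<alpha> z)\<^sup>H ** g z + (\<gamma> z)\<^sup>H) \<in> wiener_on {..-1}"
    and X4: "(\<lambda>z. g z ** \<delta> z + \<beta> z) \<in> wiener_on {..-1}"
    using sol by (simp_all add: solution_iff)
  show ?thesis
  proof (intro exI[of _ "\<lambda>k. r (int k)"] conjI ballI allI impI)
    fix z :: complex assume "z \<in> sphere 0 1"
    then have "g z = (\<Sum>\<nu>\<in>{0..int m}. z powi \<nu> *\<^sub>m r \<nu>)"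
      by (rule wiener_series_finite_support[OF r(1) _ r(2), rotated -1]) auto
    also have "\<dots> = (\<Sum>k\<le>m. z ^ k *\<^sub>m r (int k))"
      by (rule sum.reindex_bij_witness[of _ int nat]) (auto simp: power_int_def)
    finally show "g z = (\<Sum>k\<le>m. z ^ k *\<^sub>m r (int k))" .
  next
    fix i assume i: "i \<le> m"
    show "r (int i) = - block_apply m (toeplitz_b m b) e i"
      using toeplitz_b_formula[OF toeplitz_d_row[OF r(1) r_large X4] e i] by simp
  next
    fix i assume i: "i \<le> m"
    have "r (int i) = block_apply m (block_inv m (toeplitz_a_adj a))
        (block_apply m (toeplitz_a_adj a) (\<lambda>k. r (int k))) i"
      by (rule block_apply_block_inv_left[OF block_invertible_toeplitz_a_adj i, symmetric])
    also have "\<dots> = block_apply m (block_inv m (toeplitz_a_adj a)) (\<lambda>k. - (c (- int k))\<^sup>H) i"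
      using X2 unfolding toeplitz_a_adj_iff[OF r(1) r_large]
      by (intro block_apply_cong) simp_all
    finally show "r (int i) = - block_apply m (block_inv m (toeplitz_a_adj a)) (\<lambda>k. (c (- int k))\<^sup>H) i"
      by (simp only: block_apply_minus)
  qed
qed

text \<open>
  The triangular system makes the second condition hold for a polynomial \<open>g\<close>. By the identities
  it implies the first and the fourth multiplied by \<open>\<alpha>\<^sup>*\<close> from the left, and the fourth implies
  the third multiplied by \<open>\<delta>\<close> from the right; both factors can be cancelled.
\<close>

lemma identities_imp_solution:
  assumes id\<alpha>: "\<And>z. z \<in> sphere 0 1 \<Longrightarrow> (\<alpha> z)\<^sup>H ** \<alpha> z - (\<gamma> z)\<^sup>H ** \<gamma> z = a 0"
    and id\<delta>: "\<And>z. z \<in> sphere 0 1 \<Longrightarrow> (\<delta> z)\<^sup>H ** \<delta> z - (\<beta> z)\<^sup>H ** \<beta> z = d 0"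
    and idod: "\<And>z. z \<in> sphere 0 1 \<Longrightarrow> (\<alpha> z)\<^sup>H ** \<beta> z = (\<gamma> z)\<^sup>H ** \<delta> z"
  shows "\<exists>g. twofold_EG_solution \<alpha> \<beta> \<gamma> \<delta> g"
proof -
  define G where "G = block_apply m (block_inv m (toeplitz_a_adj a)) (\<lambda>k. - (c (- int k))\<^sup>H)"
  define g where "g = (\<lambda>z. \<Sum>k\<le>m. z powi int k *\<^sub>m G k)"
  define r where "r = (\<lambda>\<nu>. \<Sum>k\<le>m. if \<nu> = int k then G k else 0)"
  have r: "wiener_series r g"
    unfolding r_def g_def by (rule wiener_series_laurent_polynomial)
  have r_large: "\<forall>\<nu>>int m. r \<nu> = 0"
    by (auto simp: r_def intro: sum.neutral)
  have g_on: "g \<in> wiener_on {0..int m}"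
    unfolding g_def by (rule wiener_on_laurent_polynomial) auto
  let ?X1 = "\<lambda>z. \<alpha> z + g z ** \<gamma> z - mat 1" and ?X2 = "\<lambda>z. (\<alpha> z)\<^sup>H ** g z + (\<gamma> z)\<^sup>H"
    and ?X3 = "\<lambda>z. (\<delta> z)\<^sup>H + (\<beta> z)\<^sup>H ** g z - mat 1" and ?X4 = "\<lambda>z. g z ** \<delta> z + \<beta> z"
  have X2: "?X2 \<in> wiener_on {..-1}"
    unfolding toeplitz_a_adj_iff[OF r r_large]
  proof (intro allI impI)
    fix i assume i: "i \<le> m"
    have "block_apply m (toeplitz_a_adj a) (\<lambda>k. r (int k)) i = block_apply m (toeplitz_a_adj a) G i"
      by (intro block_apply_cong) (simp_all add: r_def)
    also have "\<dots> = - (c (- int i))\<^sup>H"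
      unfolding G_def by (rule block_apply_block_inv_right[OF block_invertible_toeplitz_a_adj i])
    finally show "block_apply m (toeplitz_a_adj a) (\<lambda>k. r (int k)) i = - (c (- int i))\<^sup>H" .
  qed
  \<comment> \<open>A crude upper bound on the spectra, needed to start the cancellations.\<close>
  have bounded: "?X1 \<in> wiener_on {..int m}" "?X3 \<in> wiener_on {..int m}" "?X4 \<in> wiener_on {..int m}"
  proof -
    have "(\<lambda>z. g z ** \<gamma> z) \<in> wiener_on {..int m}" "(\<lambda>z. (\<beta> z)\<^sup>H ** g z) \<in> wiener_on {..int m}"
      "(\<lambda>z. g z ** \<delta> z) \<in> wiener_on {..int m}"
      using wiener_on_mult_right[OF \<gamma>_on _ g_on] wiener_on_mult_left[OF \<beta>H_on _ g_on]
        wiener_on_mult_right[OF \<delta>_on _ g_on] by auto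
    moreover have "\<alpha> \<in> wiener_on {..int m}" "\<beta> \<in> wiener_on {..int m}"
      "(\<lambda>z. (\<delta> z)\<^sup>H) \<in> wiener_on {..int m}"
      using wiener_on_mono[OF \<alpha>_on] wiener_on_mono[OF \<beta>_on] wiener_on_mono[OF \<delta>H_on] by auto
    ultimately show "?X1 \<in> wiener_on {..int m}" "?X3 \<in> wiener_on {..int m}" "?X4 \<in> wiener_on {..int m}"
      by (intro wiener_on_add wiener_on_diff wiener_on_const; simp)+
  qed
  \<comment> \<open>The left side of the first identity is Hermitian at every point of the circle;
    the point 1 is as good as any.\<close>
  have "(a 0)\<^sup>H = a 0"
    by (simp add: conj_transpose_algebra flip: id\<alpha>[of 1])
  have X1: "?X1 \<in> wiener_on {..-1}"
  proof (rule \<alpha>H_cancel[OF bounded(1)])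
    have "(\<lambda>z. ?X2 z ** \<gamma> z - (\<alpha> z - a 0)\<^sup>H) \<in> wiener_on {..-1}"
      using wiener_on_mult_right[OF \<gamma>_on _ X2] wiener_on_conj_transpose[OF \<alpha>_minus_a0_on]
      by (intro wiener_on_diff) auto
    then show "(\<lambda>z. (\<alpha> z)\<^sup>H ** ?X1 z) \<in> wiener_on {..-1}"
    proof (rule wiener_on_cong)
      fix z :: complex assume "z \<in> sphere 0 1"
      from id\<alpha>[OF this] show "(\<alpha> z)\<^sup>H ** ?X1 z = ?X2 z ** \<gamma> z - (\<alpha> z - a 0)\<^sup>H"
        by (simp add: conj_transpose_algebra matrix_algebra matrix_mul_assoc \<open>(a 0)\<^sup>H = a 0\<close> algebra_simps)
    qed
  qed
  have X4: "?X4 \<in> wiener_on {..-1}"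
  proof (rule \<alpha>H_cancel[OF bounded(3)])
    have "(\<lambda>z. ?X2 z ** \<delta> z) \<in> wiener_on {..-1}"
      using wiener_on_mult_right[OF \<delta>_on _ X2] by auto
    then show "(\<lambda>z. (\<alpha> z)\<^sup>H ** ?X4 z) \<in> wiener_on {..-1}"
      by (rule wiener_on_cong) (simp add: matrix_algebra matrix_mul_assoc idod)
  qed
  have X3: "?X3 \<in> wiener_on {..-1}"
  proof (rule \<delta>_cancel[OF bounded(2)])
    \<comment> \<open>The second identity turns \<open>?X3 z ** \<delta> z\<close> into this
      combination, whose constant terms cancel.\<close>
    have "(\<lambda>z. (\<beta> z)\<^sup>H ** ?X4 z - (\<delta> z - d 0)) \<in> wiener_on {..-1}"
      using wiener_on_mult_left[OF \<beta>H_on _ X4] \<delta>_minus_d0_on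
      by - (rule wiener_on_diff; auto)
    then show "(\<lambda>z. ?X3 z ** \<delta> z) \<in> wiener_on {..-1}"
    proof (rule wiener_on_cong)
      fix z :: complex assume "z \<in> sphere 0 1"
      from id\<delta>[OF this] show "?X3 z ** \<delta> z = (\<beta> z)\<^sup>H ** ?X4 z - (\<delta> z - d 0)"
        by (simp add: matrix_algebra matrix_mul_assoc algebra_simps)
    qed
  qed
  have "g \<in> wiener_on {0..}"
    using g_on by (rule wiener_on_mono) auto
  with X1 X2 X3 X4 show ?thesis unfolding solution_iff by blast
qed

end

theorem theorem9p1:
  fixes m :: nat
    and a :: "nat \<Rightarrow> complex^'p^'p" and b :: "nat \<Rightarrow> complex^'q^'p"
    and c :: "int \<Rightarrow> complex^'p^'q" and d :: "int \<Rightarrow> complex^'q^'q"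
    and \<alpha> :: "complex \<Rightarrow> complex^'p^'p" and \<beta> :: "complex \<Rightarrow> complex^'q^'p"
    and \<gamma> :: "complex \<Rightarrow> complex^'p^'q" and \<delta> :: "complex \<Rightarrow> complex^'q^'q"
    and e :: "nat \<Rightarrow> complex^'q^'q"
  assumes \<alpha>: "\<alpha> = (\<lambda>z. \<Sum>j\<le>m. z ^ j *\<^sub>m a j)"
    and \<beta>: "\<beta> = (\<lambda>z. \<Sum>j\<le>m. z ^ j *\<^sub>m b j)"
    and \<gamma>: "\<gamma> = (\<lambda>z. \<Sum>j\<le>m. z powi (- int j) *\<^sub>m c (- int j))"
    and \<delta>: "\<delta> = (\<lambda>z. \<Sum>j\<le>m. z powi (- int j) *\<^sub>m d (- int j))"
    and a0: "invertible (a 0)"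
    and d0: "invertible (d 0)"
    and e: "\<forall>i\<le>m. e (m - i) =
              block_apply m (block_inv m (toeplitz_d d)) (\<lambda>k. if k = m then mat 1 else 0) i"
  shows
    "((\<exists>g. twofold_EG_solution \<alpha> \<beta> \<gamma> \<delta> g) \<longleftrightarrow>
        (\<forall>z\<in>sphere 0 1.
           (\<alpha> z)\<^sup>H ** \<alpha> z - (\<gamma> z)\<^sup>H ** \<gamma> z = a 0 \<and>
           (\<delta> z)\<^sup>H ** \<delta> z - (\<beta> z)\<^sup>H ** \<beta> z = d 0 \<and>
           (\<alpha> z)\<^sup>H ** \<beta> z = (\<gamma> z)\<^sup>H ** \<delta> z))
     \<and> block_invertible m (toeplitz_d d)
     \<and> block_invertible m (toeplitz_a_adj a)
     \<and> (\<forall>g. twofold_EG_solution \<alpha> \<beta> \<gamma> \<delta> g \<longrightarrow>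
          (\<forall>h. twofold_EG_solution \<alpha> \<beta> \<gamma> \<delta> h \<longrightarrow> (\<forall>z\<in>sphere 0 1. h z = g z)) \<and>
          (\<exists>G :: nat \<Rightarrow> complex^'q^'p.
             (\<forall>z\<in>sphere 0 1. g z = (\<Sum>k\<le>m. z ^ k *\<^sub>m G k)) \<and>
             (\<forall>i\<le>m. G i = - block_apply m (toeplitz_b m b) (\<lambda>k. e (m - k)) i) \<and>
             (\<forall>i\<le>m. G i = - block_apply m (block_inv m (toeplitz_a_adj a))
                                 (\<lambda>k. (c (- int k))\<^sup>H) i)))"
proof -
  interpret twofold_EG_data m a b c d \<alpha> \<beta> \<gamma> \<delta>
    using \<alpha> \<beta> \<gamma> \<delta> a0 d0 by unfold_locales
  \<comment> \<open>The block column is listed with the highest index on top, hence the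
    reversal.\<close>
  define E where "E = (\<lambda>k. e (m - k))"
  have E: "block_apply m (toeplitz_d d) E i = (if i = m then mat 1 else 0)" if "i \<le> m" for i
  proof -
    have "block_apply m (toeplitz_d d) E i = block_apply m (toeplitz_d d)
        (block_apply m (block_inv m (toeplitz_d d)) (\<lambda>k. if k = m then mat 1 else 0)) i"
      using e by (intro block_apply_cong) (simp_all add: E_def)
    also have "\<dots> = (if i = m then mat 1 else 0)"
      by (rule block_apply_block_inv_right[OF block_invertible_toeplitz_d that])
    finally show ?thesis .
  qed
  have equal: "h z = g z"
    if g: "twofold_EG_solution \<alpha> \<beta> \<gamma> \<delta> g" and h: "twofold_EG_solution \<alpha> \<beta> \<gamma> \<delta> h"
      and z: "z \<in> sphere 0 1" for g h z
  proof -
    obtain G where G: "\<forall>z\<in>sphere 0 1. g z = (\<Sum>k\<le>m. z ^ k *\<^sub>m G k)"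
      "\<forall>i\<le>m. G i = - block_apply m (toeplitz_b m b) E i"
      using solution_coefficients[OF g E] by blast
    obtain H where H: "\<forall>z\<in>sphere 0 1. h z = (\<Sum>k\<le>m. z ^ k *\<^sub>m H k)"
      "\<forall>i\<le>m. H i = - block_apply m (toeplitz_b m b) E i"
      using solution_coefficients[OF h E] by blast
    show ?thesis
      unfolding G(1)[rule_format, OF z] H(1)[rule_format, OF z] by (intro sum.cong) (simp_all add: G(2) H(2))
  qed
  show ?thesis
  proof (intro conjI allI impI)
    show "(\<exists>g. twofold_EG_solution \<alpha> \<beta> \<gamma> \<delta> g) \<longleftrightarrow>
        (\<forall>z\<in>sphere 0 1.
           (\<alpha> z)\<^sup>H ** \<alpha> z - (\<gamma> z)\<^sup>H ** \<gamma> z = a 0 \<and>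
           (\<delta> z)\<^sup>H ** \<delta> z - (\<beta> z)\<^sup>H ** \<beta> z = d 0 \<and>
           (\<alpha> z)\<^sup>H ** \<beta> z = (\<gamma> z)\<^sup>H ** \<delta> z)"
      using solution_imp_identities by (intro iffI identities_imp_solution) blast+
    show "block_invertible m (toeplitz_d d)" by (rule block_invertible_toeplitz_d)
    show "block_invertible m (toeplitz_a_adj a)" by (rule block_invertible_toeplitz_a_adj)
  next
    fix g h assume "twofold_EG_solution \<alpha> \<beta> \<gamma> \<delta> g" "twofold_EG_solution \<alpha> \<beta> \<gamma> \<delta> h"
    then show "\<forall>z\<in>sphere 0 1. h z = g z" using equal by blast
  next
    fix g assume "twofold_EG_solution \<alpha> \<beta> \<gamma> \<delta> g"
    from solution_coefficients[OF this E]
    show "\<exists>G :: nat \<Rightarrow> complex^'q^'p.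
             (\<forall>z\<in>sphere 0 1. g z = (\<Sum>k\<le>m. z ^ k *\<^sub>m G k)) \<and>
             (\<forall>i\<le>m. G i = - block_apply m (toeplitz_b m b) (\<lambda>k. e (m - k)) i) \<and>
             (\<forall>i\<le>m. G i = - block_apply m (block_inv m (toeplitz_a_adj a))
                                 (\<lambda>k. (c (- int k))\<^sup>H) i)"
      unfolding E_def .
  qed
qed

end
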